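(* Let $H$ be a monoid and $N$ an abelian group. Let $\Gamma$ and $\Psi$ be cosetal extensions of $H$ by $N$ corresponding to $[g_1]_{E}\in\mathcal{H}^2(H,N,E,[\phi_1])$ and $[g_2]_{E'}\in\mathcal{H}^2(H,N,E',[\phi_2])$ respectively, and let $\mathrm{Hom}(\Gamma,\Psi)$ be the set of morphisms of extensions from $\Gamma$ to $\Psi$. If it is not the case that both $(E,[\phi_1])\le(E',[\phi_2])$ and $[g_1]_{E'}=[g_2]_{E'}$, then $\mathrm{Hom}(\Gamma,\Psi)=\emptyset$. If $(E,[\phi_1])\le(E',[\phi_2])$ and $[g_1]_{E'}=[g_2]_{E'}$, then, writing $\Gamma\colon N\xrightarrow{k_1}N\rtimes_{E,\phi}^g H\xrightarrow{e_1}H$ and $\Psi\colon N\xrightarrow{k_2}N\rtimes_{E',\phi}^g H\xrightarrow{e_2}H$ with common representatives $\phi$ of the actions and $g$ of the cohomology classes, there is a bijection $\mathcal{Z}^1(H,N,E',[\phi])\to\mathrm{Hom}(\Gamma,\Psi)$ sending the class of a crossed homomorphism $t^*$ relative to $(E',\phi)$ to the composite $t\circ\lambda$, where $\lambda\colon\Gamma\to\Psi$ is the morphism $\lambda([n],h)=([n],h)$ and $t\colon\Psi\to\Psi$ is the automorphism $t([n],h)=([t^*(h)n],h)$. In particular, $\lambda$ corresponds to the identity of $\mathcal{Z}^1(H,N,E',[\phi])$.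
   Context: $H$ is a monoid and $N$ is an abelian group (written multiplicatively). Extensions. A diagram $N \xrightarrow{k} G \xrightarrow{e} H$ of monoids is an extension if $k$ is the kernel of $e$ ($k$ is injective with image $e^{-1}(1)$) and $e$ is the cokernel of $k$ ($e$ is, up to isomorphism, the quotient of $G$ by the congruence generated by $k(n)\sim 1$, $n\in N$). It is cosetal if whenever $e(g)=e(g')$ there is $n\in N$ with $g=k(n)g'$. A morphism of extensions of $H$ by $N$ is a monoid homomorphism $f\colon G_1\to G_2$ with $fk_1=k_2$ and $e_2f=e_1$. Compatible pairs. An $H$-indexed equivalence relation $E$ on $N$ is a family $(\sim^h)_{h\in H}$ (also written $\sim^h_E$) of equivalence relations on $N$; $E\subseteq E'$ means pointwise inclusion. $E$ is admissible if for all $n,n',x\in N$, $h,y\in H$: (1) $n\sim^1 n'$ implies $n=n'$; (2) $n\sim^h n'$ implies $xn\sim^h xn'$; (3) $n\sim^h n'$ implies $n\sim^{hy}n'$. A map $\phi\colon H\times N\to N$ is a compatible action with respect to an admissible $E$ if (1) $n\sim^h n'$ implies $n\phi(h,x)\sim^h n'\phi(h,x)$ for all $x\in N$; (2) $n\sim^h n'$ implies $\phi(x,n)\sim^{xh}\phi(x,n')$ for all $x\in H$; (3) $\phi(h,nn')\sim^h\phi(h,n)\phi(h,n')$; (4) $\phi(hh',n)\sim^{hh'}\phi(h,\phi(h',n))$; (5) $\phi(h,1)\sim^h 1$; (6) $\phi(1,n)\sim^1 n$. Then $(E,\phi)$ is a compatible pair. Write $[\phi]=[\phi]_E$ for the class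 of $\phi$ under: $\phi\sim\phi'$ iff $\phi(h,n)\sim_E^h\phi'(h,n)$ for all $h,n$. Order: $(E,[\phi]_E)\le(E',[\phi']_{E'})$ iff $E\subseteq E'$ and $[\phi]_{E'}=[\phi']_{E'}$, i.e. $\phi(h,n)\sim_{E'}^h\phi'(h,n)$ for all $h,n$. Pair associated to a cosetal extension. Let $s$ be a set-theoretic section of $e$. Put $n\sim^h n'$ iff $k(n)s(h)=k(n')s(h)$, and let $\phi(h,n)$ be any element with $k\phi(h,n)s(h)=s(h)k(n)$. This gives a compatible pair; $E$ and $[\phi]_E$ do not depend on the choices. $\mathrm{CExt}(H,N,E,[\phi])$ is the set of isomorphism classes of cosetal extensions with associated pair $(E,[\phi])$. Cohomology. A factor set for $(E,[\phi])$ is a map $g\colon H\times H\to N$ with $g(h,1)\sim^h 1\sim^h g(1,h)$ and $g(x,y)g(xy,z)\sim^{xyz}\phi(x,g(y,z))g(x,yz)$. Inner factor sets are those of the form $\delta t(h,h')=\phi(h,t(h'))\,t(hh')^{-1}t(h)$ for $t\colon H\to N$ with $t(1)=1$. Put $g\equiv g'$ iff there is an inner factor set $\delta t$ with $\delta t(h,h')\,g'(h,h')\sim^{hh'}g(h,h')$ for all $h,h'$. $\mathcal{H}^2(H,N,E,[\phi])$ is the abelian group of $\equiv$-classes $[g]=[g]_E$ of factor sets under pointwise multiplication. If $(E,[\phi])\le(E',[\phi])$, a factor set for $(E,[\phi])$ is also one for $(E',[\phi])$, and $[g]_{E'}$ denotes its class in $\mathcal{H}^2(H,N,E',[\phi])$.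 Crossed product. $N\rtimes_{E,\phi}^g H$ is the monoid with underlying set $\bigsqcup_{h\in H}N/{\sim^h}$, elements written $([n],h)$, unit $([1],1)$ and product $([n],h)([n'],h')=([n\phi(h,n')g(h,h')],hh')$; with $k(n)=([n],1)$ and $e([n],h)=h$ it is a cosetal extension of $H$ by $N$ with associated pair $(E,[\phi])$. A cosetal extension corresponds to $[g]\in\mathcal{H}^2(H,N,E,[\phi])$ if it is isomorphic, as an extension, to $N\rtimes_{E,\phi}^g H$; this gives a bijection between $\mathrm{CExt}(H,N,E,[\phi])$ and $\mathcal{H}^2(H,N,E,[\phi])$. Crossed homomorphisms. A function $t^*\colon H\to N$ is a crossed homomorphism relative to $(E,\phi)$ if $t^*(hh')\sim^{hh'}t^*(h)\phi(h,t^*(h'))$ for all $h,h'\in H$. $\mathcal{Z}^1(H,N,E,[\phi])$ is the set of equivalence classes of crossed homomorphisms under $t_1^*\sim t_2^*$ iff $t_1^*(h)\sim^h t_2^*(h)$ for all $h$, an abelian group under pointwise multiplication. *)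

theory Defs
  imports "HOL-Algebra.Group"
begin

section \<open>Monoid homomorphisms, congruences, quotients\<close>

text \<open>\<open>hom\<close> does not require preservation of the unit, which is not automatic for monoids.\<close>

definition unital_hom :: "('a, 'b) monoid_scheme \<Rightarrow> ('c, 'd) monoid_scheme \<Rightarrow> ('a \<Rightarrow> 'c) set"
  where "unital_hom G K = {f \<in> hom G K. f \<one>\<^bsub>G\<^esub> = \<one>\<^bsub>K\<^esub>}"

definition monoid_congruence :: "('a, 'b) monoid_scheme \<Rightarrow> ('a \<times> 'a) set \<Rightarrow> bool"
  where "monoid_congruence G R \<longleftrightarrow>
    equiv (carrier G) R \<and>
    (\<forall>x y x' y'. (x, y) \<in> R \<longrightarrow> (x', y') \<in> R \<longrightarrow> (x \<otimes>\<^bsub>G\<^esub> x', y \<otimes>\<^bsub>G\<^esub> y') \<in> R)"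

definition generated_congruence :: "('a, 'b) monoid_scheme \<Rightarrow> ('a \<times> 'a) set \<Rightarrow> ('a \<times> 'a) set"
  where "generated_congruence G S = \<Inter> {R. monoid_congruence G R \<and> S \<subseteq> R}"

definition quotient_monoid :: "('a, 'b) monoid_scheme \<Rightarrow> ('a \<times> 'a) set \<Rightarrow> 'a set monoid"
  where "quotient_monoid G R =
    \<lparr>carrier = carrier G // R,
     mult = (\<lambda>A B. \<Union>a\<in>A. \<Union>b\<in>B. R `` {a \<otimes>\<^bsub>G\<^esub> b}),
     one = R `` {\<one>\<^bsub>G\<^esub>}\<rparr>"


section \<open>Extensions\<close>

text \<open>A diagram from \<open>N\<close> to \<open>H\<close> through the middle monoid.\<close>

record ('n, 'g, 'h) ext_diagram =
  kmap :: "'n \<Rightarrow> 'g"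
  mid :: "'g monoid"
  emap :: "'g \<Rightarrow> 'h"

definition coker_congruence ::
    "('n, 'a) monoid_scheme \<Rightarrow> ('n, 'g, 'h) ext_diagram \<Rightarrow> ('g \<times> 'g) set"
  where "coker_congruence N \<Gamma> =
    generated_congruence (mid \<Gamma>) ((\<lambda>n. (kmap \<Gamma> n, \<one>\<^bsub>mid \<Gamma>\<^esub>)) ` carrier N)"

locale extension = N: comm_group N + H: monoid H + G: monoid "mid \<Gamma>"
  for N :: "('n, 'a) monoid_scheme" and H :: "('h, 'b) monoid_scheme"
    and \<Gamma> :: "('n, 'g, 'h) ext_diagram" +
  assumes kmap_hom: "kmap \<Gamma> \<in> unital_hom N (mid \<Gamma>)"
    and emap_hom: "emap \<Gamma> \<in> unital_hom (mid \<Gamma>) H"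
    and kernel_inj: "inj_on (kmap \<Gamma>) (carrier N)"
    and kernel_image: "kmap \<Gamma> ` carrier N = {x \<in> carrier (mid \<Gamma>). emap \<Gamma> x = \<one>\<^bsub>H\<^esub>}"
    and cokernel: "\<exists>i \<in> iso (quotient_monoid (mid \<Gamma>) (coker_congruence N \<Gamma>)) H.
          \<forall>x \<in> carrier (mid \<Gamma>). i (coker_congruence N \<Gamma> `` {x}) = emap \<Gamma> x"

locale cosetal_extension = extension N H \<Gamma>
  for N :: "('n, 'a) monoid_scheme" and H :: "('h, 'b) monoid_scheme"
    and \<Gamma> :: "('n, 'g, 'h) ext_diagram" +
  assumes cosetal: "\<lbrakk>x \<in> carrier (mid \<Gamma>); x' \<in> carrier (mid \<Gamma>); emap \<Gamma> x = emap \<Gamma> x'\<rbrakk>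
    \<Longrightarrow> \<exists>n \<in> carrier N. x = kmap \<Gamma> n \<otimes>\<^bsub>mid \<Gamma>\<^esub> x'"

text \<open>Morphisms are taken extensional, so that \<open>ext_hom N \<Gamma> \<Psi>\<close> is the actual set of maps
  between the carriers and bijections onto it are meaningful.\<close>

definition ext_hom ::
    "('n, 'a) monoid_scheme \<Rightarrow> ('n, 'g, 'h) ext_diagram \<Rightarrow> ('n, 'k, 'h) ext_diagram
      \<Rightarrow> ('g \<Rightarrow> 'k) set"
  where "ext_hom N \<Gamma> \<Psi> =
    {f \<in> unital_hom (mid \<Gamma>) (mid \<Psi>) \<inter> extensional (carrier (mid \<Gamma>)).
       (\<forall>n \<in> carrier N. f (kmap \<Gamma> n) = kmap \<Psi> n) \<and>
       (\<forall>x \<in> carrier (mid \<Gamma>). emap \<Psi> (f x) = emap \<Gamma> x)}"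

definition ext_iso ::
    "('n, 'a) monoid_scheme \<Rightarrow> ('n, 'g, 'h) ext_diagram \<Rightarrow> ('n, 'k, 'h) ext_diagram
      \<Rightarrow> ('g \<Rightarrow> 'k) set"
  where "ext_iso N \<Gamma> \<Psi> =
    {f \<in> ext_hom N \<Gamma> \<Psi>. bij_betw f (carrier (mid \<Gamma>)) (carrier (mid \<Psi>))}"


section \<open>Compatible pairs\<close>

locale admissible = N: comm_group N + H: monoid H
  for N :: "('n, 'a) monoid_scheme" and H :: "('h, 'b) monoid_scheme" +
  fixes E :: "'h \<Rightarrow> ('n \<times> 'n) set"
  assumes equiv_E: "h \<in> carrier H \<Longrightarrow> equiv (carrier N) (E h)"
    and E_one: "(n, n') \<in> E \<one>\<^bsub>H\<^esub> \<Longrightarrow> n = n'"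
    and E_mult: "\<lbrakk>h \<in> carrier H; x \<in> carrier N; (n, n') \<in> E h\<rbrakk>
          \<Longrightarrow> (x \<otimes>\<^bsub>N\<^esub> n, x \<otimes>\<^bsub>N\<^esub> n') \<in> E h"
    and E_right: "\<lbrakk>h \<in> carrier H; y \<in> carrier H; (n, n') \<in> E h\<rbrakk>
          \<Longrightarrow> (n, n') \<in> E (h \<otimes>\<^bsub>H\<^esub> y)"

locale compatible_pair = admissible N H E
  for N :: "('n, 'a) monoid_scheme" and H :: "('h, 'b) monoid_scheme"
    and E :: "'h \<Rightarrow> ('n \<times> 'n) set" +
  fixes \<phi> :: "'h \<Rightarrow> 'n \<Rightarrow> 'n"
  assumes act_closed: "\<lbrakk>h \<in> carrier H; n \<in> carrier N\<rbrakk> \<Longrightarrow> \<phi> h n \<in> carrier N"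
    and act_cong_mult: "\<lbrakk>h \<in> carrier H; x \<in> carrier N; (n, n') \<in> E h\<rbrakk>
          \<Longrightarrow> (n \<otimes>\<^bsub>N\<^esub> \<phi> h x, n' \<otimes>\<^bsub>N\<^esub> \<phi> h x) \<in> E h"
    and act_cong: "\<lbrakk>h \<in> carrier H; y \<in> carrier H; (n, n') \<in> E h\<rbrakk>
          \<Longrightarrow> (\<phi> y n, \<phi> y n') \<in> E (y \<otimes>\<^bsub>H\<^esub> h)"
    and act_mult: "\<lbrakk>h \<in> carrier H; n \<in> carrier N; n' \<in> carrier N\<rbrakk>
          \<Longrightarrow> (\<phi> h (n \<otimes>\<^bsub>N\<^esub> n'), \<phi> h n \<otimes>\<^bsub>N\<^esub> \<phi> h n') \<in> E h"
    and act_act: "\<lbrakk>h \<in> carrier H; h' \<in> carrier H; n \<in> carrier N\<rbrakk>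
          \<Longrightarrow> (\<phi> (h \<otimes>\<^bsub>H\<^esub> h') n, \<phi> h (\<phi> h' n)) \<in> E (h \<otimes>\<^bsub>H\<^esub> h')"
    and act_unit: "h \<in> carrier H \<Longrightarrow> (\<phi> h \<one>\<^bsub>N\<^esub>, \<one>\<^bsub>N\<^esub>) \<in> E h"
    and act_one: "n \<in> carrier N \<Longrightarrow> (\<phi> \<one>\<^bsub>H\<^esub> n, n) \<in> E \<one>\<^bsub>H\<^esub>"

text \<open>\<open>act_class N H E \<phi>\<close> is the class \<open>[\<phi>]\<^sub>E\<close>.\<close>

definition act_class ::
    "('n, 'a) monoid_scheme \<Rightarrow> ('h, 'b) monoid_scheme \<Rightarrow> ('h \<Rightarrow> ('n \<times> 'n) set)
      \<Rightarrow> ('h \<Rightarrow> 'n \<Rightarrow> 'n) \<Rightarrow> ('h \<Rightarrow> 'n \<Rightarrow> 'n) set"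
  where "act_class N H E \<phi> =
    {\<psi>. compatible_pair N H E \<psi> \<and> (\<forall>h \<in> carrier H. \<forall>n \<in> carrier N. (\<phi> h n, \<psi> h n) \<in> E h)}"

definition pair_le ::
    "('n, 'a) monoid_scheme \<Rightarrow> ('h, 'b) monoid_scheme \<Rightarrow> ('h \<Rightarrow> ('n \<times> 'n) set)
      \<Rightarrow> ('h \<Rightarrow> 'n \<Rightarrow> 'n) \<Rightarrow> ('h \<Rightarrow> ('n \<times> 'n) set) \<Rightarrow> ('h \<Rightarrow> 'n \<Rightarrow> 'n) \<Rightarrow> bool"
  where "pair_le N H E \<phi> E' \<phi>' \<longleftrightarrow>
    (\<forall>h \<in> carrier H. E h \<subseteq> E' h) \<and> act_class N H E' \<phi> = act_class N H E' \<phi>'"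


section \<open>Second cohomology\<close>

text \<open>Cochains are functions on the whole type. Only their values on the carrier matter:
  cochains agreeing there have the same class. Likewise the notions below use a representative
  \<open>\<phi>\<close> of the class of actions but depend only on \<open>[\<phi>]\<^sub>E\<close>.\<close>

definition factor_sets ::
    "('n, 'a) monoid_scheme \<Rightarrow> ('h, 'b) monoid_scheme \<Rightarrow> ('h \<Rightarrow> ('n \<times> 'n) set)
      \<Rightarrow> ('h \<Rightarrow> 'n \<Rightarrow> 'n) \<Rightarrow> ('h \<Rightarrow> 'h \<Rightarrow> 'n) set"
  where "factor_sets N H E \<phi> =
    {g \<in> carrier H \<rightarrow> carrier H \<rightarrow> carrier N.
       (\<forall>h \<in> carrier H. (g h \<one>\<^bsub>H\<^esub>, \<one>\<^bsub>N\<^esub>) \<in> E h \<and> (\<one>\<^bsub>N\<^esub>, g \<one>\<^bsub>H\<^esub> h) \<in> E h) \<and>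
       (\<forall>x \<in> carrier H. \<forall>y \<in> carrier H. \<forall>z \<in> carrier H.
          (g x y \<otimes>\<^bsub>N\<^esub> g (x \<otimes>\<^bsub>H\<^esub> y) z, \<phi> x (g y z) \<otimes>\<^bsub>N\<^esub> g x (y \<otimes>\<^bsub>H\<^esub> z))
            \<in> E (x \<otimes>\<^bsub>H\<^esub> y \<otimes>\<^bsub>H\<^esub> z))}"

definition coboundary ::
    "('n, 'a) monoid_scheme \<Rightarrow> ('h, 'b) monoid_scheme \<Rightarrow> ('h \<Rightarrow> 'n \<Rightarrow> 'n)
      \<Rightarrow> ('h \<Rightarrow> 'n) \<Rightarrow> 'h \<Rightarrow> 'h \<Rightarrow> 'n"
  where "coboundary N H \<phi> t h h' =
    \<phi> h (t h') \<otimes>\<^bsub>N\<^esub> inv\<^bsub>N\<^esub> (t (h \<otimes>\<^bsub>H\<^esub> h')) \<otimes>\<^bsub>N\<^esub> t h"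

definition coh_rel ::
    "('n, 'a) monoid_scheme \<Rightarrow> ('h, 'b) monoid_scheme \<Rightarrow> ('h \<Rightarrow> ('n \<times> 'n) set)
      \<Rightarrow> ('h \<Rightarrow> 'n \<Rightarrow> 'n) \<Rightarrow> (('h \<Rightarrow> 'h \<Rightarrow> 'n) \<times> ('h \<Rightarrow> 'h \<Rightarrow> 'n)) set"
  where "coh_rel N H E \<phi> =
    {(g, g'). g \<in> factor_sets N H E \<phi> \<and> g' \<in> factor_sets N H E \<phi> \<and>
       (\<exists>t \<in> carrier H \<rightarrow> carrier N. t \<one>\<^bsub>H\<^esub> = \<one>\<^bsub>N\<^esub> \<and>
          (\<forall>h \<in> carrier H. \<forall>h' \<in> carrier H.
             (coboundary N H \<phi> t h h' \<otimes>\<^bsub>N\<^esub> g' h h', g h h') \<in> E (h \<otimes>\<^bsub>H\<^esub> h')))}"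

text \<open>The class \<open>[g]\<^sub>E\<close>; it is empty if \<open>g\<close> is not a factor set for \<open>(E, [\<phi>])\<close>.\<close>

definition coh_class ::
    "('n, 'a) monoid_scheme \<Rightarrow> ('h, 'b) monoid_scheme \<Rightarrow> ('h \<Rightarrow> ('n \<times> 'n) set)
      \<Rightarrow> ('h \<Rightarrow> 'n \<Rightarrow> 'n) \<Rightarrow> ('h \<Rightarrow> 'h \<Rightarrow> 'n) \<Rightarrow> ('h \<Rightarrow> 'h \<Rightarrow> 'n) set"
  where "coh_class N H E \<phi> g = coh_rel N H E \<phi> `` {g}"

definition H2 ::
    "('n, 'a) monoid_scheme \<Rightarrow> ('h, 'b) monoid_scheme \<Rightarrow> ('h \<Rightarrow> ('n \<times> 'n) set)
      \<Rightarrow> ('h \<Rightarrow> 'n \<Rightarrow> 'n) \<Rightarrow> ('h \<Rightarrow> 'h \<Rightarrow> 'n) set monoid"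
  where "H2 N H E \<phi> =
    \<lparr>carrier = factor_sets N H E \<phi> // coh_rel N H E \<phi>,
     mult = (\<lambda>A B. \<Union>a\<in>A. \<Union>b\<in>B. coh_class N H E \<phi> (\<lambda>h h'. a h h' \<otimes>\<^bsub>N\<^esub> b h h')),
     one = coh_class N H E \<phi> (\<lambda>h h'. \<one>\<^bsub>N\<^esub>)\<rparr>"


section \<open>Crossed products\<close>

definition crossed_carrier ::
    "('n, 'a) monoid_scheme \<Rightarrow> ('h, 'b) monoid_scheme \<Rightarrow> ('h \<Rightarrow> ('n \<times> 'n) set)
      \<Rightarrow> ('n set \<times> 'h) set"
  where "crossed_carrier N H E = {(A, h). h \<in> carrier H \<and> A \<in> carrier N // E h}"

definition crossed_product ::
    "('n, 'a) monoid_scheme \<Rightarrow> ('h, 'b) monoid_scheme \<Rightarrow> ('h \<Rightarrow> ('n \<times> 'n) set)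
      \<Rightarrow> ('h \<Rightarrow> 'n \<Rightarrow> 'n) \<Rightarrow> ('h \<Rightarrow> 'h \<Rightarrow> 'n) \<Rightarrow> ('n, 'n set \<times> 'h, 'h) ext_diagram"
  where "crossed_product N H E \<phi> g =
    \<lparr>kmap = (\<lambda>n. (E \<one>\<^bsub>H\<^esub> `` {n}, \<one>\<^bsub>H\<^esub>)),
     mid =
       \<lparr>carrier = crossed_carrier N H E,
        mult = (\<lambda>(A, h) (A', h').
          (\<Union>n\<in>A. \<Union>n'\<in>A'. E (h \<otimes>\<^bsub>H\<^esub> h') `` {n \<otimes>\<^bsub>N\<^esub> \<phi> h n' \<otimes>\<^bsub>N\<^esub> g h h'}, h \<otimes>\<^bsub>H\<^esub> h')),
        one = (E \<one>\<^bsub>H\<^esub> `` {\<one>\<^bsub>N\<^esub>}, \<one>\<^bsub>H\<^esub>)\<rparr>,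
     emap = snd\<rparr>"

definition corresponds ::
    "('n, 'a) monoid_scheme \<Rightarrow> ('h, 'b) monoid_scheme \<Rightarrow> ('n, 'g, 'h) ext_diagram
      \<Rightarrow> ('h \<Rightarrow> ('n \<times> 'n) set) \<Rightarrow> ('h \<Rightarrow> 'n \<Rightarrow> 'n) \<Rightarrow> ('h \<Rightarrow> 'h \<Rightarrow> 'n) \<Rightarrow> bool"
  where "corresponds N H \<Gamma> E \<phi> g \<longleftrightarrow> ext_iso N \<Gamma> (crossed_product N H E \<phi> g) \<noteq> {}"

text \<open>The maps \<open>([n]\<^sub>E, h) \<mapsto> ([n]\<^sub>E\<^sub>', h)\<close> and \<open>([n]\<^sub>E, h) \<mapsto> ([t h n]\<^sub>E, h)\<close>.\<close>

definition crossed_lambda ::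
    "('n, 'a) monoid_scheme \<Rightarrow> ('h, 'b) monoid_scheme \<Rightarrow> ('h \<Rightarrow> ('n \<times> 'n) set)
      \<Rightarrow> ('h \<Rightarrow> ('n \<times> 'n) set) \<Rightarrow> 'n set \<times> 'h \<Rightarrow> 'n set \<times> 'h"
  where "crossed_lambda N H E E' =
    (\<lambda>(A, h) \<in> crossed_carrier N H E. (\<Union>n\<in>A. E' h `` {n}, h))"

definition crossed_shift ::
    "('n, 'a) monoid_scheme \<Rightarrow> ('h, 'b) monoid_scheme \<Rightarrow> ('h \<Rightarrow> ('n \<times> 'n) set)
      \<Rightarrow> ('h \<Rightarrow> 'n) \<Rightarrow> 'n set \<times> 'h \<Rightarrow> 'n set \<times> 'h"
  where "crossed_shift N H E t =
    (\<lambda>(A, h) \<in> crossed_carrier N H E. (\<Union>n\<in>A. E h `` {t h \<otimes>\<^bsub>N\<^esub> n}, h))"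


section \<open>Crossed homomorphisms\<close>

definition crossed_homs ::
    "('n, 'a) monoid_scheme \<Rightarrow> ('h, 'b) monoid_scheme \<Rightarrow> ('h \<Rightarrow> ('n \<times> 'n) set)
      \<Rightarrow> ('h \<Rightarrow> 'n \<Rightarrow> 'n) \<Rightarrow> ('h \<Rightarrow> 'n) set"
  where "crossed_homs N H E \<phi> =
    {t \<in> carrier H \<rightarrow> carrier N. \<forall>h \<in> carrier H. \<forall>h' \<in> carrier H.
       (t (h \<otimes>\<^bsub>H\<^esub> h'), t h \<otimes>\<^bsub>N\<^esub> \<phi> h (t h')) \<in> E (h \<otimes>\<^bsub>H\<^esub> h')}"

definition crossed_hom_rel ::
    "('n, 'a) monoid_scheme \<Rightarrow> ('h, 'b) monoid_scheme \<Rightarrow> ('h \<Rightarrow> ('n \<times> 'n) set)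
      \<Rightarrow> ('h \<Rightarrow> 'n \<Rightarrow> 'n) \<Rightarrow> (('h \<Rightarrow> 'n) \<times> ('h \<Rightarrow> 'n)) set"
  where "crossed_hom_rel N H E \<phi> =
    {(t, t'). t \<in> crossed_homs N H E \<phi> \<and> t' \<in> crossed_homs N H E \<phi> \<and>
       (\<forall>h \<in> carrier H. (t h, t' h) \<in> E h)}"

definition crossed_hom_class ::
    "('n, 'a) monoid_scheme \<Rightarrow> ('h, 'b) monoid_scheme \<Rightarrow> ('h \<Rightarrow> ('n \<times> 'n) set)
      \<Rightarrow> ('h \<Rightarrow> 'n \<Rightarrow> 'n) \<Rightarrow> ('h \<Rightarrow> 'n) \<Rightarrow> ('h \<Rightarrow> 'n) set"
  where "crossed_hom_class N H E \<phi> t = crossed_hom_rel N H E \<phi> `` {t}"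

definition Z1 ::
    "('n, 'a) monoid_scheme \<Rightarrow> ('h, 'b) monoid_scheme \<Rightarrow> ('h \<Rightarrow> ('n \<times> 'n) set)
      \<Rightarrow> ('h \<Rightarrow> 'n \<Rightarrow> 'n) \<Rightarrow> ('h \<Rightarrow> 'n) set monoid"
  where "Z1 N H E \<phi> =
    \<lparr>carrier = crossed_homs N H E \<phi> // crossed_hom_rel N H E \<phi>,
     mult = (\<lambda>A B. \<Union>a\<in>A. \<Union>b\<in>B. crossed_hom_class N H E \<phi> (\<lambda>h. a h \<otimes>\<^bsub>N\<^esub> b h)),
     one = crossed_hom_class N H E \<phi> (\<lambda>h. \<one>\<^bsub>N\<^esub>)\<rparr>"


section \<open>Common representatives\<close>

text \<open>\<open>\<phi>\<close> represents both \<open>[\<phi>\<^sub>1]\<^sub>E\<close> and \<open>[\<phi>\<^sub>2]\<^sub>E\<^sub>'\<close>, and \<open>g\<close> represents both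
  \<open>[g\<^sub>1]\<^sub>E\<close> and \<open>[g\<^sub>2]\<^sub>E\<^sub>'\<close>.\<close>

definition common_reps ::
    "('n, 'a) monoid_scheme \<Rightarrow> ('h, 'b) monoid_scheme
      \<Rightarrow> ('h \<Rightarrow> ('n \<times> 'n) set) \<Rightarrow> ('h \<Rightarrow> 'n \<Rightarrow> 'n) \<Rightarrow> ('h \<Rightarrow> 'h \<Rightarrow> 'n)
      \<Rightarrow> ('h \<Rightarrow> ('n \<times> 'n) set) \<Rightarrow> ('h \<Rightarrow> 'n \<Rightarrow> 'n) \<Rightarrow> ('h \<Rightarrow> 'h \<Rightarrow> 'n)
      \<Rightarrow> ('h \<Rightarrow> 'n \<Rightarrow> 'n) \<Rightarrow> ('h \<Rightarrow> 'h \<Rightarrow> 'n) \<Rightarrow> bool"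
  where "common_reps N H E \<phi>\<^sub>1 g\<^sub>1 E' \<phi>\<^sub>2 g\<^sub>2 \<phi> g \<longleftrightarrow>
    \<phi> \<in> act_class N H E \<phi>\<^sub>1 \<and> \<phi> \<in> act_class N H E' \<phi>\<^sub>2 \<and>
    g \<in> coh_class N H E \<phi>\<^sub>1 g\<^sub>1 \<and> g \<in> coh_class N H E' \<phi>\<^sub>2 g\<^sub>2"

end

theory Submission
  imports Defs
begin

text \<open>
  Up to isomorphism, \<open>\<Gamma>\<close> and \<open>\<Psi>\<close> are the crossed products given by \<open>(E, \<phi>\<^sub>1, g\<^sub>1)\<close> and \<open>(E', \<phi>\<^sub>2, g\<^sub>2)\<close>,
  and conjugation by the isomorphisms is a bijection on hom-sets (\<open>bij_betw_ext_hom_conjugate\<close>). So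
  only morphisms \<open>f\<close> between two crossed products have to be understood.

  In a crossed product \<open>([n], h) = ([n], 1)([1], h)\<close>, and \<open>f\<close> is prescribed on \<open>([n], 1) = k(n)\<close> and
  preserves the \<open>H\<close>-component. Hence \<open>f([n], h) = ([t(h) n], h)\<close> where \<open>f([1], h) = ([t(h)], h)\<close>. For
  such a formula to define a morphism it is necessary and sufficient that \<open>E \<subseteq> E'\<close>, that \<open>\<phi>\<^sub>1\<close> and
  \<open>\<phi>\<^sub>2\<close> agree modulo \<open>E'\<close>, and that \<open>t(1) = 1\<close> and
  \<open>t(h) \<phi>\<^sub>2(h, t(h')) g\<^sub>2(h, h') \<sim> g\<^sub>1(h, h') t(hh')\<close> modulo \<open>E' (hh')\<close>
  (\<open>ext_hom_is_crossed_map\<close>, \<open>crossed_map_hom\<close>). The last condition says that \<open>t\<close> exhibits \<open>g\<^sub>1\<close> and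
  \<open>g\<^sub>2\<close> as cohomologous, so a morphism can exist only if the pairs are comparable and
  \<open>[g\<^sub>1] = [g\<^sub>2]\<close> over \<open>E'\<close>.

  Conversely, if these conditions hold, \<open>\<phi>\<^sub>1\<close> and \<open>g\<^sub>1\<close> represent the data of both extensions, and any
  common representatives \<open>\<phi>\<close>, \<open>g\<close> give crossed products isomorphic to \<open>\<Gamma>\<close> and \<open>\<Psi>\<close>
  (\<open>corresponds_change_representatives\<close>). With the same factor set on both sides, \<open>g\<close> cancels from the
  condition on \<open>t\<close>, which becomes that of a crossed homomorphism (\<open>comparison_iff_crossed_hom\<close>). Two of
  them give the same morphism if and only if \<open>t(h)\<close> and \<open>t'(h)\<close> are related by \<open>E' h\<close> for all \<open>h\<close>, which is
  the equivalence defining \<open>Z1\<close> (\<open>bij_betw_hom_of_class\<close>).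
\<close>

section \<open>Calculus of admissible relations\<close>

context admissible
begin

lemma E_closed:
  assumes "h \<in> carrier H" "(n, m) \<in> E h"
  shows "n \<in> carrier N" "m \<in> carrier N"
  using equiv_E[OF assms(1)] assms(2) by (auto simp: equiv_def)

lemma E_refl: "h \<in> carrier H \<Longrightarrow> n \<in> carrier N \<Longrightarrow> (n, n) \<in> E h"
  using equiv_E[of h] by (auto simp: equiv_def refl_on_def)

lemma E_sym: "h \<in> carrier H \<Longrightarrow> (n, m) \<in> E h \<Longrightarrow> (m, n) \<in> E h"
  using equiv_E[of h] by (auto simp: equiv_def sym_def)

lemma E_trans: "h \<in> carrier H \<Longrightarrow> (n, m) \<in> E h \<Longrightarrow> (m, l) \<in> E h \<Longrightarrow> (n, l) \<in> E h"
  using equiv_E[of h] unfolding equiv_def by (meson transD)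

lemma E_mult_both:
  assumes h: "h \<in> carrier H" and nm: "(n, m) \<in> E h" and kl: "(k, l) \<in> E h"
  shows "(n \<otimes>\<^bsub>N\<^esub> k, m \<otimes>\<^bsub>N\<^esub> l) \<in> E h"
proof -
  note [simp] = E_closed[OF h nm] E_closed[OF h kl]
  have "(n \<otimes>\<^bsub>N\<^esub> k, n \<otimes>\<^bsub>N\<^esub> l) \<in> E h" using E_mult[OF h _ kl] by simp
  moreover have "(n \<otimes>\<^bsub>N\<^esub> l, m \<otimes>\<^bsub>N\<^esub> l) \<in> E h"
    using E_mult[OF h _ nm, of l] by (simp add: N.m_comm)
  ultimately show ?thesis using E_trans h by blast
qed

lemma E_cancel:
  assumes h: "h \<in> carrier H" and x: "x \<in> carrier N" "n \<in> carrier N" "m \<in> carrier N"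
    and nm: "(x \<otimes>\<^bsub>N\<^esub> n, x \<otimes>\<^bsub>N\<^esub> m) \<in> E h"
  shows "(n, m) \<in> E h"
  using E_mult[OF h _ nm, of "inv\<^bsub>N\<^esub> x"] x by (simp add: N.m_assoc[symmetric])

lemma E_cancel_iff:
  assumes "h \<in> carrier H" "x \<in> carrier N" "n \<in> carrier N" "m \<in> carrier N"
  shows "(x \<otimes>\<^bsub>N\<^esub> n, x \<otimes>\<^bsub>N\<^esub> m) \<in> E h \<longleftrightarrow> (n, m) \<in> E h"
  using E_cancel[OF assms] E_mult[OF assms(1,2)] by blast

lemma class_eq_iff:
  assumes "h \<in> carrier H" "n \<in> carrier N" "m \<in> carrier N"
  shows "E h `` {n} = E h `` {m} \<longleftrightarrow> (n, m) \<in> E h"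
  using eq_equiv_class_iff[OF equiv_E] assms by blast

end

text \<open>Naming the element \<open>([n], h)\<close> by a representative turns all computations in crossed products
  into computations with representatives, up to \<open>E h\<close>.\<close>

definition crossed_elem :: "('h \<Rightarrow> ('n \<times> 'n) set) \<Rightarrow> 'h \<Rightarrow> 'n \<Rightarrow> 'n set \<times> 'h"
  where "crossed_elem E h n = (E h `` {n}, h)"

lemma snd_crossed_elem: "snd (crossed_elem E h n) = h"
  by (simp add: crossed_elem_def)

lemma crossed_product_simps:
  "kmap (crossed_product N H E \<phi> g) n = crossed_elem E \<one>\<^bsub>H\<^esub> n"
  "carrier (mid (crossed_product N H E \<phi> g)) = crossed_carrier N H E"
  "\<one>\<^bsub>mid (crossed_product N H E \<phi> g)\<^esub> = crossed_elem E \<one>\<^bsub>H\<^esub> \<one>\<^bsub>N\<^esub>"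
  "emap (crossed_product N H E \<phi> g) = snd"
  by (simp_all add: crossed_product_def crossed_elem_def)

context admissible
begin

lemma crossed_elem_eq_iff:
  assumes "h \<in> carrier H" "n \<in> carrier N" "m \<in> carrier N"
  shows "crossed_elem E h n = crossed_elem E h m \<longleftrightarrow> (n, m) \<in> E h"
  using class_eq_iff[OF assms] by (simp add: crossed_elem_def)

lemma crossed_elem_closed:
  "h \<in> carrier H \<Longrightarrow> n \<in> carrier N \<Longrightarrow> crossed_elem E h n \<in> crossed_carrier N H E"
  by (simp add: crossed_elem_def crossed_carrier_def quotientI)

lemma crossed_carrierE:
  assumes "x \<in> crossed_carrier N H E"
  obtains h n where "h \<in> carrier H" "n \<in> carrier N" "x = crossed_elem E h n"
  using assms by (auto simp: crossed_elem_def crossed_carrier_def elim!: quotientE)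

end

context compatible_pair
begin

text \<open>Well-definedness of the product of a crossed product in both \<open>N\<close>-components at once. A change of
  the left factor at \<open>h\<close> survives at \<open>hy\<close> because the relations grow to the right, a change of the
  right factor at \<open>y\<close> because the action carries \<open>E y\<close> into \<open>E (hy)\<close>.\<close>

lemma E_act_left:
  assumes "h \<in> carrier H" "y \<in> carrier H" "(n, m) \<in> E y"
    and "(x, z) \<in> E h"
  shows "(x \<otimes>\<^bsub>N\<^esub> \<phi> h n, z \<otimes>\<^bsub>N\<^esub> \<phi> h m) \<in> E (h \<otimes>\<^bsub>H\<^esub> y)"
  using assms by (intro E_mult_both E_right act_cong) auto

lemma crossed_mult:
  assumes g: "g \<in> carrier H \<rightarrow> carrier H \<rightarrow> carrier N"
    and h: "h \<in> carrier H" "h' \<in> carrier H" and n: "n \<in> carrier N" "n' \<in> carrier N"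
  shows "crossed_elem E h n \<otimes>\<^bsub>mid (crossed_product N H E \<phi> g)\<^esub> crossed_elem E h' n'
    = crossed_elem E (h \<otimes>\<^bsub>H\<^esub> h') (n \<otimes>\<^bsub>N\<^esub> \<phi> h n' \<otimes>\<^bsub>N\<^esub> g h h')"
proof -
  have gh: "g h h' \<in> carrier N" using g h by auto
  have "congruent2 (E h) (E h')
      (\<lambda>n n'. E (h \<otimes>\<^bsub>H\<^esub> h') `` {n \<otimes>\<^bsub>N\<^esub> \<phi> h n' \<otimes>\<^bsub>N\<^esub> g h h'})"
  proof (rule congruent2I')
    fix x z x' z' assume "(x, z) \<in> E h" "(x', z') \<in> E h'"
    moreover from this have "x \<in> carrier N" "z \<in> carrier N" "x' \<in> carrier N" "z' \<in> carrier N"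
      using E_closed h by blast+
    ultimately show "E (h \<otimes>\<^bsub>H\<^esub> h') `` {x \<otimes>\<^bsub>N\<^esub> \<phi> h x' \<otimes>\<^bsub>N\<^esub> g h h'}
        = E (h \<otimes>\<^bsub>H\<^esub> h') `` {z \<otimes>\<^bsub>N\<^esub> \<phi> h z' \<otimes>\<^bsub>N\<^esub> g h h'}"
      using h gh by (subst class_eq_iff) (auto intro!: E_mult_both[OF _ E_act_left E_refl] act_closed)
  qed
  from UN_equiv_class2[OF equiv_E[OF h(1)] equiv_E[OF h(2)] this n]
  show ?thesis by (simp add: crossed_product_def crossed_elem_def)
qed

end


section \<open>Diagrams and their isomorphisms\<close>

text \<open>The closure properties that make composites and inverses of morphisms morphisms again: they are
  what \<open>bij_betw_ext_hom_conjugate\<close> uses of extensions and of crossed products alike.\<close>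

definition closed_diagram :: "('n, 'a) monoid_scheme \<Rightarrow> ('n, 'g, 'h) ext_diagram \<Rightarrow> bool"
  where "closed_diagram N D \<longleftrightarrow>
    \<one>\<^bsub>mid D\<^esub> \<in> carrier (mid D) \<and> kmap D \<in> carrier N \<rightarrow> carrier (mid D) \<and>
    (\<forall>x \<in> carrier (mid D). \<forall>y \<in> carrier (mid D). x \<otimes>\<^bsub>mid D\<^esub> y \<in> carrier (mid D))"

lemma (in extension) closed_diagram: "closed_diagram N \<Gamma>"
  using kmap_hom by (auto simp: closed_diagram_def unital_hom_def hom_def)

lemma (in compatible_pair) closed_crossed_product:
  assumes g: "g \<in> carrier H \<rightarrow> carrier H \<rightarrow> carrier N"
  shows "closed_diagram N (crossed_product N H E \<phi> g)"
proof -
  let ?D = "crossed_product N H E \<phi> g"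
  have "x \<otimes>\<^bsub>mid ?D\<^esub> y \<in> crossed_carrier N H E"
    if xy: "x \<in> crossed_carrier N H E" "y \<in> crossed_carrier N H E" for x y
  proof -
    from xy(1) obtain h n where x: "h \<in> carrier H" "n \<in> carrier N" "x = crossed_elem E h n"
      by (rule crossed_carrierE)
    from xy(2) obtain h' n' where y: "h' \<in> carrier H" "n' \<in> carrier N" "y = crossed_elem E h' n'"
      by (rule crossed_carrierE)
    have "g h h' \<in> carrier N" using g x y by auto
    then show ?thesis using x y act_closed
      by (simp add: crossed_mult[OF g] crossed_elem_closed)
  qed
  then show ?thesis
    using crossed_elem_closed[of "\<one>\<^bsub>H\<^esub>"]
    by (simp add: closed_diagram_def crossed_product_def crossed_elem_def)
qed

lemma ext_homD:
  assumes "f \<in> ext_hom N A B"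
  shows "x \<in> carrier (mid A) \<Longrightarrow> f x \<in> carrier (mid B)"
    and "x \<in> carrier (mid A) \<Longrightarrow> y \<in> carrier (mid A) \<Longrightarrow>
      f (x \<otimes>\<^bsub>mid A\<^esub> y) = f x \<otimes>\<^bsub>mid B\<^esub> f y"
    and "f \<one>\<^bsub>mid A\<^esub> = \<one>\<^bsub>mid B\<^esub>"
    and "n \<in> carrier N \<Longrightarrow> f (kmap A n) = kmap B n"
    and "x \<in> carrier (mid A) \<Longrightarrow> emap B (f x) = emap A x"
    and "f \<in> extensional (carrier (mid A))"
  using assms by (auto simp: ext_hom_def unital_hom_def hom_def)

lemma ext_homI:
  assumes "\<And>x. x \<in> carrier (mid A) \<Longrightarrow> f x \<in> carrier (mid B)"
    and "\<And>x y. x \<in> carrier (mid A) \<Longrightarrow> y \<in> carrier (mid A) \<Longrightarrow>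
      f (x \<otimes>\<^bsub>mid A\<^esub> y) = f x \<otimes>\<^bsub>mid B\<^esub> f y"
    and "f \<one>\<^bsub>mid A\<^esub> = \<one>\<^bsub>mid B\<^esub>"
    and "\<And>n. n \<in> carrier N \<Longrightarrow> f (kmap A n) = kmap B n"
    and "\<And>x. x \<in> carrier (mid A) \<Longrightarrow> emap B (f x) = emap A x"
    and "f \<in> extensional (carrier (mid A))"
  shows "f \<in> ext_hom N A B"
  using assms by (auto simp: ext_hom_def unital_hom_def hom_def)

lemma ext_hom_compose:
  assumes A: "closed_diagram N A" and f: "f \<in> ext_hom N A B" and f': "f' \<in> ext_hom N B C"
  shows "compose (carrier (mid A)) f' f \<in> ext_hom N A C"
  using A by (intro ext_homI)
    (auto simp: closed_diagram_def compose_eq ext_homD[OF f] ext_homD[OF f'] Pi_iff)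

lemma ext_iso_hom: "f \<in> ext_iso N A B \<Longrightarrow> f \<in> ext_hom N A B"
  and ext_iso_bij: "f \<in> ext_iso N A B \<Longrightarrow> bij_betw f (carrier (mid A)) (carrier (mid B))"
  by (auto simp: ext_iso_def)

lemma ext_iso_compose:
  assumes A: "closed_diagram N A" and f: "f \<in> ext_iso N A B" and f': "f' \<in> ext_iso N B C"
  shows "compose (carrier (mid A)) f' f \<in> ext_iso N A C"
  using ext_hom_compose[OF A ext_iso_hom[OF f] ext_iso_hom[OF f']]
    bij_betw_compose[OF ext_iso_bij[OF f] ext_iso_bij[OF f']]
  by (simp add: ext_iso_def)

lemma ext_iso_inverse:
  assumes A: "closed_diagram N A" and B: "closed_diagram N B" and f: "f \<in> ext_iso N A B"
  shows "restrict (inv_into (carrier (mid A)) f) (carrier (mid B)) \<in> ext_hom N B A"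
proof -
  let ?A = "carrier (mid A)" and ?B = "carrier (mid B)"
  let ?i = "inv_into ?A f"
  note hom = ext_homD[OF ext_iso_hom[OF f]]
  have bij: "bij_betw f ?A ?B" using f by (rule ext_iso_bij)
  have i: "?i y \<in> ?A" "f (?i y) = y" if "y \<in> ?B" for y
    using that bij by (auto simp: bij_betw_inv_into_right inv_into_into bij_betw_def)
  have i_eq: "?i y = x" if "x \<in> ?A" "f x = y" for x y
    using that bij by (auto simp: bij_betw_inv_into_left)
  note closed = A[unfolded closed_diagram_def] B[unfolded closed_diagram_def]
  show ?thesis
  proof (rule ext_homI)
    fix x y assume "x \<in> ?B" "y \<in> ?B"
    with closed i hom(2) show "restrict ?i ?B (x \<otimes>\<^bsub>mid B\<^esub> y)
        = restrict ?i ?B x \<otimes>\<^bsub>mid A\<^esub> restrict ?i ?B y"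
      by (auto intro!: i_eq)
  next
    fix x assume "x \<in> ?B"
    with i hom(5)[of "?i x"] show "emap A (restrict ?i ?B x) = emap B x" by simp
  qed (use closed i hom in \<open>auto intro!: i_eq\<close>)
qed

text \<open>This reduces every question about morphisms between two extensions to their crossed product
  models. Both maps of the bijection are composites of morphisms, the inverse of an isomorphism being
  one as well.\<close>

lemma bij_betw_ext_hom_conjugate:
  assumes A: "closed_diagram N A" "closed_diagram N A'"
    and B: "closed_diagram N B" "closed_diagram N B'"
    and \<alpha>: "\<alpha> \<in> ext_iso N A A'" and \<beta>: "\<beta> \<in> ext_iso N B B'"
  shows "bij_betw
    (\<lambda>f. compose (carrier (mid A)) (inv_into (carrier (mid B)) \<beta>) (compose (carrier (mid A)) f \<alpha>))
    (ext_hom N A' B') (ext_hom N A B)"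
proof -
  let ?A = "carrier (mid A)" and ?A' = "carrier (mid A')"
  let ?B = "carrier (mid B)" and ?B' = "carrier (mid B')"
  let ?a = "restrict (inv_into ?A \<alpha>) ?A'" and ?b = "restrict (inv_into ?B \<beta>) ?B'"
  let ?to = "\<lambda>f. compose ?A (inv_into ?B \<beta>) (compose ?A f \<alpha>)"
  let ?from = "\<lambda>f. compose ?A' \<beta> (compose ?A' f ?a)"
  note a_hom = ext_iso_inverse[OF A \<alpha>] and b_hom = ext_iso_inverse[OF B \<beta>]
  note \<alpha>_hom = ext_iso_hom[OF \<alpha>] and \<beta>_hom = ext_iso_hom[OF \<beta>]
  note inv = bij_betw_inv_into_left[OF ext_iso_bij[OF \<alpha>]] bij_betw_inv_into_right[OF ext_iso_bij[OF \<alpha>]]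
    bij_betw_inv_into_left[OF ext_iso_bij[OF \<beta>]] bij_betw_inv_into_right[OF ext_iso_bij[OF \<beta>]]
  have a_closed: "inv_into ?A \<alpha> y \<in> ?A" if "y \<in> ?A'" for y
    using ext_homD(1)[OF a_hom, of y] that by simp
  have b_closed: "inv_into ?B \<beta> y \<in> ?B" if "y \<in> ?B'" for y
    using ext_homD(1)[OF b_hom, of y] that by simp
  note closed = a_closed b_closed ext_homD(1)[OF \<alpha>_hom] ext_homD(1)[OF \<beta>_hom]
  show ?thesis
  proof (rule bij_betw_byWitness[where f' = ?from])
    show "\<forall>f \<in> ext_hom N A' B'. ?from (?to f) = f"
      by (auto intro!: extensionalityI[OF compose_extensional] simp: compose_eq inv closed ext_homD)
    show "\<forall>f \<in> ext_hom N A B. ?to (?from f) = f"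
      by (auto intro!: extensionalityI[OF compose_extensional] simp: compose_eq inv closed ext_homD)
    show "?from ` ext_hom N A B \<subseteq> ext_hom N A' B'"
      using A a_hom \<beta>_hom by (auto intro!: ext_hom_compose)
    have "?to f = compose ?A ?b (compose ?A f \<alpha>)" if "f \<in> ext_hom N A' B'" for f
      by (rule extensionalityI[OF compose_extensional compose_extensional])
        (use that in \<open>simp add: compose_eq closed ext_homD\<close>)
    then show "?to ` ext_hom N A' B' \<subseteq> ext_hom N A B"
      using A \<alpha>_hom b_hom by (auto intro!: ext_hom_compose)
  qed
qed


section \<open>Factor sets and cohomology classes\<close>

context compatible_pair
begin

lemma act_class_self: "\<phi> \<in> act_class N H E \<phi>"
  using compatible_pair_axioms E_refl act_closed by (auto simp: act_class_def)

lemma factor_setsD: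
  assumes "g \<in> factor_sets N H E \<phi>"
  shows "g \<in> carrier H \<rightarrow> carrier H \<rightarrow> carrier N"
    and "h \<in> carrier H \<Longrightarrow> h' \<in> carrier H \<Longrightarrow> g h h' \<in> carrier N"
    and "h \<in> carrier H \<Longrightarrow> (g h \<one>\<^bsub>H\<^esub>, \<one>\<^bsub>N\<^esub>) \<in> E h"
    and "h \<in> carrier H \<Longrightarrow> (g \<one>\<^bsub>H\<^esub> h, \<one>\<^bsub>N\<^esub>) \<in> E h"
    and "x \<in> carrier H \<Longrightarrow> y \<in> carrier H \<Longrightarrow> z \<in> carrier H \<Longrightarrow>
      (g x y \<otimes>\<^bsub>N\<^esub> g (x \<otimes>\<^bsub>H\<^esub> y) z, \<phi> x (g y z) \<otimes>\<^bsub>N\<^esub> g x (y \<otimes>\<^bsub>H\<^esub> z)) \<in> E (x \<otimes>\<^bsub>H\<^esub> y \<otimes>\<^bsub>H\<^esub> z)"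
  using assms E_sym by (auto simp: factor_sets_def)

end

text \<open>This is the condition on \<open>t\<close> for \<open>([n], h) \<mapsto> ([t(h) n], h)\<close> to be multiplicative from the
  crossed product with factor set \<open>g\<close> to the one with \<open>(\<phi>, g')\<close>: it compares the images of
  \<open>([1], h)([1], h')\<close>. Dividing by \<open>t(hh')\<close> gives \<open>g \<sim> \<delta>t g'\<close>, so one notion covers
  cohomologous factor sets and, for \<open>g = g'\<close>, crossed homomorphisms.\<close>

definition comparison_cochain ::
    "('n, 'a) monoid_scheme \<Rightarrow> ('h, 'b) monoid_scheme \<Rightarrow> ('h \<Rightarrow> ('n \<times> 'n) set)
      \<Rightarrow> ('h \<Rightarrow> 'n \<Rightarrow> 'n) \<Rightarrow> ('h \<Rightarrow> 'h \<Rightarrow> 'n) \<Rightarrow> ('h \<Rightarrow> 'h \<Rightarrow> 'n) \<Rightarrow> ('h \<Rightarrow> 'n) \<Rightarrow> bool"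
  where "comparison_cochain N H E \<phi> g g' t \<longleftrightarrow>
    t \<in> carrier H \<rightarrow> carrier N \<and> t \<one>\<^bsub>H\<^esub> = \<one>\<^bsub>N\<^esub> \<and>
    (\<forall>h \<in> carrier H. \<forall>h' \<in> carrier H.
      (t h \<otimes>\<^bsub>N\<^esub> \<phi> h (t h') \<otimes>\<^bsub>N\<^esub> g' h h', g h h' \<otimes>\<^bsub>N\<^esub> t (h \<otimes>\<^bsub>H\<^esub> h')) \<in> E (h \<otimes>\<^bsub>H\<^esub> h'))"

context compatible_pair
begin

text \<open>Multiplication by \<open>t(hh')\<close>, which is invertible on classes, clears the inverse in \<open>\<delta>t\<close>.\<close>

lemma coh_rel_iff_comparison:
  "(g, g') \<in> coh_rel N H E \<phi> \<longleftrightarrow>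
    g \<in> factor_sets N H E \<phi> \<and> g' \<in> factor_sets N H E \<phi> \<and>
    (\<exists>t. comparison_cochain N H E \<phi> g g' t)"
proof -
  have "(coboundary N H \<phi> t h h' \<otimes>\<^bsub>N\<^esub> g' h h', g h h') \<in> E (h \<otimes>\<^bsub>H\<^esub> h') \<longleftrightarrow>
      (t h \<otimes>\<^bsub>N\<^esub> \<phi> h (t h') \<otimes>\<^bsub>N\<^esub> g' h h', g h h' \<otimes>\<^bsub>N\<^esub> t (h \<otimes>\<^bsub>H\<^esub> h')) \<in> E (h \<otimes>\<^bsub>H\<^esub> h')"
    if g: "g \<in> factor_sets N H E \<phi>" "g' \<in> factor_sets N H E \<phi>" and t: "t \<in> carrier H \<rightarrow> carrier N"
      and h: "h \<in> carrier H" "h' \<in> carrier H" for t h h'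
  proof -
    note [simp] = factor_setsD(2)[OF g(1) h] factor_setsD(2)[OF g(2) h] h
      act_closed[OF h(1), of "t h'"] funcset_mem[OF t]
    have e: "t (h \<otimes>\<^bsub>H\<^esub> h') \<otimes>\<^bsub>N\<^esub> (coboundary N H \<phi> t h h' \<otimes>\<^bsub>N\<^esub> g' h h')
        = t h \<otimes>\<^bsub>N\<^esub> \<phi> h (t h') \<otimes>\<^bsub>N\<^esub> g' h h'"
    proof -
      have "t (h \<otimes>\<^bsub>H\<^esub> h') \<otimes>\<^bsub>N\<^esub> (coboundary N H \<phi> t h h' \<otimes>\<^bsub>N\<^esub> g' h h')
          = (t (h \<otimes>\<^bsub>H\<^esub> h') \<otimes>\<^bsub>N\<^esub> inv\<^bsub>N\<^esub> t (h \<otimes>\<^bsub>H\<^esub> h')) \<otimes>\<^bsub>N\<^esub> (t h \<otimes>\<^bsub>N\<^esub> \<phi> h (t h') \<otimes>\<^bsub>N\<^esub> g' h h')"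
        unfolding coboundary_def by (simp add: N.m_ac)
      then show ?thesis by simp
    qed
    have c: "coboundary N H \<phi> t h h' \<in> carrier N" by (simp add: coboundary_def)
    have "(coboundary N H \<phi> t h h' \<otimes>\<^bsub>N\<^esub> g' h h', g h h') \<in> E (h \<otimes>\<^bsub>H\<^esub> h') \<longleftrightarrow>
      (t (h \<otimes>\<^bsub>H\<^esub> h') \<otimes>\<^bsub>N\<^esub> (coboundary N H \<phi> t h h' \<otimes>\<^bsub>N\<^esub> g' h h'), t (h \<otimes>\<^bsub>H\<^esub> h') \<otimes>\<^bsub>N\<^esub> g h h')
        \<in> E (h \<otimes>\<^bsub>H\<^esub> h')"
      by (rule E_cancel_iff[symmetric]) (use c in simp_all)
    then show ?thesis unfolding e by (simp add: N.m_comm)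
  qed
  then show ?thesis unfolding coh_rel_def comparison_cochain_def by blast
qed

lemma comparison_refl:
  assumes g: "g \<in> factor_sets N H E \<phi>"
  shows "comparison_cochain N H E \<phi> g g (\<lambda>_. \<one>\<^bsub>N\<^esub>)"
  unfolding comparison_cochain_def
proof (intro conjI ballI)
  fix h h' assume h: "h \<in> carrier H" "h' \<in> carrier H"
  have "(\<phi> h \<one>\<^bsub>N\<^esub> \<otimes>\<^bsub>N\<^esub> g h h', \<one>\<^bsub>N\<^esub> \<otimes>\<^bsub>N\<^esub> g h h') \<in> E (h \<otimes>\<^bsub>H\<^esub> h')"
    using h factor_setsD(2)[OF g h] by (intro E_mult_both E_right act_unit E_refl) auto
  then show "(\<one>\<^bsub>N\<^esub> \<otimes>\<^bsub>N\<^esub> \<phi> h \<one>\<^bsub>N\<^esub> \<otimes>\<^bsub>N\<^esub> g h h', g h h' \<otimes>\<^bsub>N\<^esub> \<one>\<^bsub>N\<^esub>) \<in> E (h \<otimes>\<^bsub>H\<^esub> h')"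
    using h factor_setsD(2)[OF g h] act_closed by simp
qed auto

lemma act_mult_right:
  assumes "h \<in> carrier H" "h' \<in> carrier H" "n \<in> carrier N" "m \<in> carrier N"
  shows "(\<phi> h (n \<otimes>\<^bsub>N\<^esub> m), \<phi> h n \<otimes>\<^bsub>N\<^esub> \<phi> h m) \<in> E (h \<otimes>\<^bsub>H\<^esub> h')"
  using assms by (intro E_right act_mult)

text \<open>On \<open>E (hh')\<close> the map \<open>\<phi> h\<close> is multiplicative, so \<open>\<delta>(tt') \<sim> \<delta>t \<delta>t'\<close>.\<close>

lemma comparison_trans:
  assumes g: "g \<in> factor_sets N H E \<phi>" "g' \<in> factor_sets N H E \<phi>" "g'' \<in> factor_sets N H E \<phi>"
    and t: "comparison_cochain N H E \<phi> g g' t" and t': "comparison_cochain N H E \<phi> g' g'' t'"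
  shows "comparison_cochain N H E \<phi> g g'' (\<lambda>h. t h \<otimes>\<^bsub>N\<^esub> t' h)"
  unfolding comparison_cochain_def
proof (intro conjI ballI)
  have tc: "t h \<in> carrier N" "t' h \<in> carrier N" if "h \<in> carrier H" for h
    using that t t' by (auto simp: comparison_cochain_def)
  show "(\<lambda>h. t h \<otimes>\<^bsub>N\<^esub> t' h) \<in> carrier H \<rightarrow> carrier N" using tc by auto
  show "t \<one>\<^bsub>H\<^esub> \<otimes>\<^bsub>N\<^esub> t' \<one>\<^bsub>H\<^esub> = \<one>\<^bsub>N\<^esub>" using t t' by (simp add: comparison_cochain_def)
  fix h h' assume h: "h \<in> carrier H" "h' \<in> carrier H"
  let ?k = "h \<otimes>\<^bsub>H\<^esub> h'"
  note [simp] = tc h act_closed factor_setsD(2)[OF g(1)] factor_setsD(2)[OF g(2)] factor_setsD(2)[OF g(3)]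
  have k: "?k \<in> carrier H" by simp
  have "((t h \<otimes>\<^bsub>N\<^esub> t' h \<otimes>\<^bsub>N\<^esub> g'' h h') \<otimes>\<^bsub>N\<^esub> \<phi> h (t h' \<otimes>\<^bsub>N\<^esub> t' h'),
      (t h \<otimes>\<^bsub>N\<^esub> t' h \<otimes>\<^bsub>N\<^esub> g'' h h') \<otimes>\<^bsub>N\<^esub> (\<phi> h (t h') \<otimes>\<^bsub>N\<^esub> \<phi> h (t' h'))) \<in> E ?k"
    by (intro E_mult act_mult_right) auto
  then have "((t h \<otimes>\<^bsub>N\<^esub> t' h) \<otimes>\<^bsub>N\<^esub> \<phi> h (t h' \<otimes>\<^bsub>N\<^esub> t' h') \<otimes>\<^bsub>N\<^esub> g'' h h',
      (t h \<otimes>\<^bsub>N\<^esub> \<phi> h (t h')) \<otimes>\<^bsub>N\<^esub> (t' h \<otimes>\<^bsub>N\<^esub> \<phi> h (t' h') \<otimes>\<^bsub>N\<^esub> g'' h h')) \<in> E ?k" (is "(?L, _) \<in> _")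
    by (simp add: N.m_ac)
  moreover have "((t h \<otimes>\<^bsub>N\<^esub> \<phi> h (t h')) \<otimes>\<^bsub>N\<^esub> (t' h \<otimes>\<^bsub>N\<^esub> \<phi> h (t' h') \<otimes>\<^bsub>N\<^esub> g'' h h'),
      (t h \<otimes>\<^bsub>N\<^esub> \<phi> h (t h')) \<otimes>\<^bsub>N\<^esub> (g' h h' \<otimes>\<^bsub>N\<^esub> t' ?k)) \<in> E ?k"
    using t' by (intro E_mult) (auto simp: comparison_cochain_def)
  ultimately have "(?L, (t h \<otimes>\<^bsub>N\<^esub> \<phi> h (t h')) \<otimes>\<^bsub>N\<^esub> (g' h h' \<otimes>\<^bsub>N\<^esub> t' ?k)) \<in> E ?k"
    using E_trans[OF k] by blast
  then have "(?L, t' ?k \<otimes>\<^bsub>N\<^esub> (t h \<otimes>\<^bsub>N\<^esub> \<phi> h (t h') \<otimes>\<^bsub>N\<^esub> g' h h')) \<in> E ?k"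
    by (simp add: N.m_ac)
  moreover have "(t' ?k \<otimes>\<^bsub>N\<^esub> (t h \<otimes>\<^bsub>N\<^esub> \<phi> h (t h') \<otimes>\<^bsub>N\<^esub> g' h h'), t' ?k \<otimes>\<^bsub>N\<^esub> (g h h' \<otimes>\<^bsub>N\<^esub> t ?k)) \<in> E ?k"
    using t by (intro E_mult) (auto simp: comparison_cochain_def)
  ultimately have "(?L, t' ?k \<otimes>\<^bsub>N\<^esub> (g h h' \<otimes>\<^bsub>N\<^esub> t ?k)) \<in> E ?k"
    using E_trans[OF k] by blast
  then show "(?L, g h h' \<otimes>\<^bsub>N\<^esub> (t ?k \<otimes>\<^bsub>N\<^esub> t' ?k)) \<in> E ?k"
    by (simp add: N.m_ac)
qed

text \<open>Again by multiplicativity of \<open>\<phi> h\<close> on \<open>E (hh')\<close>: the value at \<open>t(h')\<inverse>\<close> is inverse to the value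
  at \<open>t(h')\<close>, up to \<open>E (hh')\<close>.\<close>

lemma comparison_sym:
  assumes g: "g \<in> factor_sets N H E \<phi>" "g' \<in> factor_sets N H E \<phi>"
    and t: "comparison_cochain N H E \<phi> g g' t"
  shows "comparison_cochain N H E \<phi> g' g (\<lambda>h. inv\<^bsub>N\<^esub> (t h))"
  unfolding comparison_cochain_def
proof (intro conjI ballI)
  have tc: "t h \<in> carrier N" if "h \<in> carrier H" for h
    using that t by (auto simp: comparison_cochain_def)
  show "(\<lambda>h. inv\<^bsub>N\<^esub> t h) \<in> carrier H \<rightarrow> carrier N" using tc by auto
  show "inv\<^bsub>N\<^esub> t \<one>\<^bsub>H\<^esub> = \<one>\<^bsub>N\<^esub>" using t by (simp add: comparison_cochain_def)
  fix h h' assume h: "h \<in> carrier H" "h' \<in> carrier H"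
  let ?k = "h \<otimes>\<^bsub>H\<^esub> h'"
  note [simp] = tc h act_closed factor_setsD(2)[OF g(1)] factor_setsD(2)[OF g(2)]
  have k: "?k \<in> carrier H" by simp
  have "(\<phi> h (t h' \<otimes>\<^bsub>N\<^esub> inv\<^bsub>N\<^esub> t h'), \<phi> h (t h') \<otimes>\<^bsub>N\<^esub> \<phi> h (inv\<^bsub>N\<^esub> t h')) \<in> E ?k"
    by (intro act_mult_right) auto
  moreover have "(\<phi> h (t h' \<otimes>\<^bsub>N\<^esub> inv\<^bsub>N\<^esub> t h'), \<one>\<^bsub>N\<^esub>) \<in> E ?k"
    by simp (intro E_right act_unit, auto)
  ultimately have u: "(\<phi> h (t h') \<otimes>\<^bsub>N\<^esub> \<phi> h (inv\<^bsub>N\<^esub> t h'), \<one>\<^bsub>N\<^esub>) \<in> E ?k"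
    using E_sym[OF k] E_trans[OF k] by blast
  \<comment> \<open>The rearrangements are stated for variables: on the terms at hand, the cancellation rules for
    inverses interfere with sorting the factors.\<close>
  have perm1: "(a \<otimes>\<^bsub>N\<^esub> b \<otimes>\<^bsub>N\<^esub> c) \<otimes>\<^bsub>N\<^esub> (x \<otimes>\<^bsub>N\<^esub> y) = (y \<otimes>\<^bsub>N\<^esub> b) \<otimes>\<^bsub>N\<^esub> (a \<otimes>\<^bsub>N\<^esub> c \<otimes>\<^bsub>N\<^esub> x)"
    if "a \<in> carrier N" "b \<in> carrier N" "c \<in> carrier N" "x \<in> carrier N" "y \<in> carrier N" for a b c x y
    using that by (simp add: N.m_ac)
  have perm2: "(a \<otimes>\<^bsub>N\<^esub> b \<otimes>\<^bsub>N\<^esub> c) \<otimes>\<^bsub>N\<^esub> (x \<otimes>\<^bsub>N\<^esub> y \<otimes>\<^bsub>N\<^esub> z)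
      = (x \<otimes>\<^bsub>N\<^esub> a) \<otimes>\<^bsub>N\<^esub> ((z \<otimes>\<^bsub>N\<^esub> b) \<otimes>\<^bsub>N\<^esub> (y \<otimes>\<^bsub>N\<^esub> c))"
    if "a \<in> carrier N" "b \<in> carrier N" "c \<in> carrier N" "x \<in> carrier N" "y \<in> carrier N" "z \<in> carrier N"
    for a b c x y z
    using that by (simp add: N.m_ac)
  \<comment> \<open>Multiply the comparison by \<open>t(h)\<inverse> t(hh')\<inverse> \<phi>(h, t(h')\<inverse>)\<close> and cancel \<open>\<phi>(h, t(h'))\<close> with \<open>u\<close>.\<close>
  let ?a = "inv\<^bsub>N\<^esub> t h" and ?b = "inv\<^bsub>N\<^esub> t ?k" and ?c = "\<phi> h (inv\<^bsub>N\<^esub> t h')"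
  have "(g h h' \<otimes>\<^bsub>N\<^esub> t ?k, t h \<otimes>\<^bsub>N\<^esub> \<phi> h (t h') \<otimes>\<^bsub>N\<^esub> g' h h') \<in> E ?k"
    using t E_sym[OF k] by (auto simp: comparison_cochain_def)
  then have "((?a \<otimes>\<^bsub>N\<^esub> ?b \<otimes>\<^bsub>N\<^esub> ?c) \<otimes>\<^bsub>N\<^esub> (g h h' \<otimes>\<^bsub>N\<^esub> t ?k),
      (?a \<otimes>\<^bsub>N\<^esub> ?b \<otimes>\<^bsub>N\<^esub> ?c) \<otimes>\<^bsub>N\<^esub> (t h \<otimes>\<^bsub>N\<^esub> \<phi> h (t h') \<otimes>\<^bsub>N\<^esub> g' h h')) \<in> E ?k"
    by (intro E_mult) auto
  moreover have "(?a \<otimes>\<^bsub>N\<^esub> ?b \<otimes>\<^bsub>N\<^esub> ?c) \<otimes>\<^bsub>N\<^esub> (g h h' \<otimes>\<^bsub>N\<^esub> t ?k)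
      = (t ?k \<otimes>\<^bsub>N\<^esub> ?b) \<otimes>\<^bsub>N\<^esub> (?a \<otimes>\<^bsub>N\<^esub> ?c \<otimes>\<^bsub>N\<^esub> g h h')"
    by (rule perm1) auto
  moreover have "(?a \<otimes>\<^bsub>N\<^esub> ?b \<otimes>\<^bsub>N\<^esub> ?c) \<otimes>\<^bsub>N\<^esub> (t h \<otimes>\<^bsub>N\<^esub> \<phi> h (t h') \<otimes>\<^bsub>N\<^esub> g' h h')
      = (t h \<otimes>\<^bsub>N\<^esub> ?a) \<otimes>\<^bsub>N\<^esub> ((g' h h' \<otimes>\<^bsub>N\<^esub> ?b) \<otimes>\<^bsub>N\<^esub> (\<phi> h (t h') \<otimes>\<^bsub>N\<^esub> ?c))"
    by (rule perm2) auto
  ultimately have "(?a \<otimes>\<^bsub>N\<^esub> ?c \<otimes>\<^bsub>N\<^esub> g h h', (g' h h' \<otimes>\<^bsub>N\<^esub> ?b) \<otimes>\<^bsub>N\<^esub> (\<phi> h (t h') \<otimes>\<^bsub>N\<^esub> ?c)) \<in> E ?k"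
    by simp
  moreover have "((g' h h' \<otimes>\<^bsub>N\<^esub> ?b) \<otimes>\<^bsub>N\<^esub> (\<phi> h (t h') \<otimes>\<^bsub>N\<^esub> ?c), (g' h h' \<otimes>\<^bsub>N\<^esub> ?b) \<otimes>\<^bsub>N\<^esub> \<one>\<^bsub>N\<^esub>) \<in> E ?k"
    using u by (intro E_mult) auto
  ultimately show "(?a \<otimes>\<^bsub>N\<^esub> ?c \<otimes>\<^bsub>N\<^esub> g h h', g' h h' \<otimes>\<^bsub>N\<^esub> ?b) \<in> E ?k"
    using E_trans[OF k] by fastforce
qed

lemma equiv_coh_rel: "equiv (factor_sets N H E \<phi>) (coh_rel N H E \<phi>)"
proof (rule equivI)
  show "coh_rel N H E \<phi> \<subseteq> factor_sets N H E \<phi> \<times> factor_sets N H E \<phi>" by (auto simp: coh_rel_def)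
  show "refl_on (factor_sets N H E \<phi>) (coh_rel N H E \<phi>)"
    using comparison_refl by (auto simp: refl_on_def coh_rel_iff_comparison)
  show "sym (coh_rel N H E \<phi>)"
    using comparison_sym by (fastforce simp: sym_def coh_rel_iff_comparison)
  show "trans (coh_rel N H E \<phi>)"
  proof (rule transI)
    fix g g' g'' assume "(g, g') \<in> coh_rel N H E \<phi>" "(g', g'') \<in> coh_rel N H E \<phi>"
    then show "(g, g'') \<in> coh_rel N H E \<phi>"
      unfolding coh_rel_iff_comparison using comparison_trans by blast
  qed
qed

text \<open>The relation holds between factor sets only, so the class of any other cochain is empty, whereas
  the elements of the cohomology group are nonempty.\<close>

lemma factor_set_if_class_in_H2:
  assumes "coh_class N H E \<phi> g \<in> carrier (H2 N H E \<phi>)"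
  shows "g \<in> factor_sets N H E \<phi>"
proof -
  from assms obtain g' where "g' \<in> factor_sets N H E \<phi>" "coh_rel N H E \<phi> `` {g} = coh_rel N H E \<phi> `` {g'}"
    by (auto simp: H2_def coh_class_def elim: quotientE)
  then have "(g, g') \<in> coh_rel N H E \<phi>" using equiv_class_self[OF equiv_coh_rel] by blast
  then show ?thesis by (auto simp: coh_rel_def)
qed

lemma coh_class_eq_iff:
  assumes "g' \<in> factor_sets N H E \<phi>"
  shows "coh_class N H E \<phi> g = coh_class N H E \<phi> g' \<longleftrightarrow> (g, g') \<in> coh_rel N H E \<phi>"
  unfolding coh_class_def
  using assms equiv_class_eq[OF equiv_coh_rel] equiv_class_self[OF equiv_coh_rel] by blast

end


section \<open>Morphisms between crossed products\<close>

text \<open>The common form \<open>([n], h) \<mapsto> ([t(h) n], h)\<close> of all maps between crossed products below: the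
  projection onto the coarser relation is the case \<open>t = 1\<close>, the shift automorphisms are the case
  \<open>E = E'\<close>.\<close>

definition crossed_map ::
    "('n, 'a) monoid_scheme \<Rightarrow> ('h, 'b) monoid_scheme \<Rightarrow> ('h \<Rightarrow> ('n \<times> 'n) set)
      \<Rightarrow> ('h \<Rightarrow> ('n \<times> 'n) set) \<Rightarrow> ('h \<Rightarrow> 'n) \<Rightarrow> 'n set \<times> 'h \<Rightarrow> 'n set \<times> 'h"
  where "crossed_map N H E E' t =
    (\<lambda>(A, h) \<in> crossed_carrier N H E. (\<Union>n\<in>A. E' h `` {t h \<otimes>\<^bsub>N\<^esub> n}, h))"

locale two_pairs = compatible_pair N H E \<phi> + Q: compatible_pair N H E' \<phi>'
  for N :: "('n, 'a) monoid_scheme" and H :: "('h, 'b) monoid_scheme"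
    and E E' :: "'h \<Rightarrow> ('n \<times> 'n) set" and \<phi> \<phi>' :: "'h \<Rightarrow> 'n \<Rightarrow> 'n"
begin

definition finer :: bool
  where "finer \<longleftrightarrow> (\<forall>h \<in> carrier H. E h \<subseteq> E' h) \<and>
    (\<forall>h \<in> carrier H. \<forall>n \<in> carrier N. (\<phi> h n, \<phi>' h n) \<in> E' h)"

lemma finerD:
  assumes finer
  shows "h \<in> carrier H \<Longrightarrow> (n, m) \<in> E h \<Longrightarrow> (n, m) \<in> E' h"
    and "h \<in> carrier H \<Longrightarrow> n \<in> carrier N \<Longrightarrow> (\<phi> h n, \<phi>' h n) \<in> E' h"
    and "h \<in> carrier H \<Longrightarrow> n \<in> carrier N \<Longrightarrow> (\<phi>' h n, \<phi> h n) \<in> E' h"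
    and "h \<in> carrier H \<Longrightarrow> y \<in> carrier H \<Longrightarrow> n \<in> carrier N \<Longrightarrow> (\<phi> h n, \<phi>' h n) \<in> E' (h \<otimes>\<^bsub>H\<^esub> y)"
    and "h \<in> carrier H \<Longrightarrow> y \<in> carrier H \<Longrightarrow> n \<in> carrier N \<Longrightarrow> (\<phi>' h n, \<phi> h n) \<in> E' (h \<otimes>\<^bsub>H\<^esub> y)"
  using assms Q.E_right Q.E_sym unfolding finer_def by blast+

lemma act_class_eq_iff:
  "act_class N H E' \<phi> = act_class N H E' \<phi>' \<longleftrightarrow>
    (\<forall>h \<in> carrier H. \<forall>n \<in> carrier N. (\<phi> h n, \<phi>' h n) \<in> E' h)"
proof
  assume "act_class N H E' \<phi> = act_class N H E' \<phi>'"
  with Q.act_class_self have "\<phi>' \<in> act_class N H E' \<phi>" by simp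
  then show "\<forall>h \<in> carrier H. \<forall>n \<in> carrier N. (\<phi> h n, \<phi>' h n) \<in> E' h" by (simp add: act_class_def)
next
  assume "\<forall>h \<in> carrier H. \<forall>n \<in> carrier N. (\<phi> h n, \<phi>' h n) \<in> E' h"
  then show "act_class N H E' \<phi> = act_class N H E' \<phi>'"
    unfolding act_class_def using Q.E_trans Q.E_sym by blast
qed

lemma pair_le_iff_finer: "pair_le N H E \<phi> E' \<phi>' \<longleftrightarrow> finer"
  by (simp add: pair_le_def finer_def act_class_eq_iff)

text \<open>The equations for the action \<open>\<phi>\<close> hold up to \<open>E\<close> and hence up to \<open>E'\<close>. That \<open>\<phi>\<close> respects the
  coarser relations \<open>E'\<close> cannot come from \<open>E\<close>; it is inherited from \<open>\<phi>'\<close>.\<close>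

lemma compatible_if_finer:
  assumes finer
  shows "compatible_pair N H E' \<phi>"
proof -
  note R = finerD[OF assms]
  show ?thesis
  proof
    fix h y n n' assume h: "h \<in> carrier H" "y \<in> carrier H" "(n, n') \<in> E' h"
    then have n: "n \<in> carrier N" "n' \<in> carrier N" using Q.E_closed by auto
    show "(\<phi> y n, \<phi> y n') \<in> E' (y \<otimes>\<^bsub>H\<^esub> h)"
      using Q.E_trans[OF _ R(4) Q.E_trans[OF _ Q.act_cong R(5)]] h n by auto
  next
    fix h h' n assume h: "h \<in> carrier H" "h' \<in> carrier H" and n: "n \<in> carrier N"
    show "(\<phi> (h \<otimes>\<^bsub>H\<^esub> h') n, \<phi> h (\<phi> h' n)) \<in> E' (h \<otimes>\<^bsub>H\<^esub> h')"
      using h n act_act by (intro R(1)) auto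
  qed (use R act_closed act_mult act_unit act_one Q.E_mult_both Q.E_refl in auto)
qed

lemma factor_sets_mono:
  assumes finer
  shows "factor_sets N H E \<phi> \<subseteq> factor_sets N H E' \<phi>'"
proof
  note R = finerD[OF assms]
  fix g assume g: "g \<in> factor_sets N H E \<phi>"
  note gD = factor_setsD[OF g]
  show "g \<in> factor_sets N H E' \<phi>'"
    unfolding factor_sets_def
  proof (intro CollectI conjI ballI)
    fix x y z assume x: "x \<in> carrier H" "y \<in> carrier H" "z \<in> carrier H"
    let ?k = "x \<otimes>\<^bsub>H\<^esub> y \<otimes>\<^bsub>H\<^esub> z"
    have "(g x y \<otimes>\<^bsub>N\<^esub> g (x \<otimes>\<^bsub>H\<^esub> y) z, \<phi> x (g y z) \<otimes>\<^bsub>N\<^esub> g x (y \<otimes>\<^bsub>H\<^esub> z)) \<in> E' ?k"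
      using x by (intro R(1) gD(5)) auto
    moreover have "(\<phi> x (g y z) \<otimes>\<^bsub>N\<^esub> g x (y \<otimes>\<^bsub>H\<^esub> z), \<phi>' x (g y z) \<otimes>\<^bsub>N\<^esub> g x (y \<otimes>\<^bsub>H\<^esub> z)) \<in> E' ?k"
      using x R(4)[of x "y \<otimes>\<^bsub>H\<^esub> z"] gD(2)
      by (intro Q.E_mult_both Q.E_refl) (auto simp: H.m_assoc)
    ultimately show "(g x y \<otimes>\<^bsub>N\<^esub> g (x \<otimes>\<^bsub>H\<^esub> y) z, \<phi>' x (g y z) \<otimes>\<^bsub>N\<^esub> g x (y \<otimes>\<^bsub>H\<^esub> z)) \<in> E' ?k"
      using x Q.E_trans[of ?k] by blast
  qed (use gD(1) R(1) gD(3,4) Q.E_sym in auto)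
qed

lemma crossed_map_elem:
  assumes "E h \<subseteq> E' h" and t: "t h \<in> carrier N" and h: "h \<in> carrier H" and n: "n \<in> carrier N"
  shows "crossed_map N H E E' t (crossed_elem E h n) = crossed_elem E' h (t h \<otimes>\<^bsub>N\<^esub> n)"
proof -
  have "(\<lambda>n. E' h `` {t h \<otimes>\<^bsub>N\<^esub> n}) respects E h"
  proof (rule congruentI)
    fix x y assume xy: "(x, y) \<in> E h"
    then have "(t h \<otimes>\<^bsub>N\<^esub> x, t h \<otimes>\<^bsub>N\<^esub> y) \<in> E' h" using assms by (blast intro: Q.E_mult)
    then show "E' h `` {t h \<otimes>\<^bsub>N\<^esub> x} = E' h `` {t h \<otimes>\<^bsub>N\<^esub> y}"
      using Q.class_eq_iff E_closed[OF h xy] h t by simp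
  qed
  from UN_equiv_class[OF equiv_E[OF h] this n] show ?thesis
    using crossed_elem_closed[OF h n] by (simp add: crossed_map_def crossed_elem_def)
qed

lemma crossed_map_eqI:
  assumes E: "\<And>h. h \<in> carrier H \<Longrightarrow> E h \<subseteq> E' h" and t: "t \<in> carrier H \<rightarrow> carrier N"
    and f: "f \<in> extensional (crossed_carrier N H E)"
    and f_elem: "\<And>h n. h \<in> carrier H \<Longrightarrow> n \<in> carrier N \<Longrightarrow>
      f (crossed_elem E h n) = crossed_elem E' h (t h \<otimes>\<^bsub>N\<^esub> n)"
  shows "f = crossed_map N H E E' t"
proof (rule extensionalityI[OF f])
  show "crossed_map N H E E' t \<in> extensional (crossed_carrier N H E)"
    unfolding crossed_map_def by (rule restrict_extensional)
  fix x assume "x \<in> crossed_carrier N H E"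
  then show "f x = crossed_map N H E E' t x"
    using f_elem crossed_map_elem[OF E funcset_mem[OF t]] by (elim crossed_carrierE) simp
qed

lemma crossed_map_eq_iff:
  assumes E: "\<And>h. h \<in> carrier H \<Longrightarrow> E h \<subseteq> E' h"
    and t: "t \<in> carrier H \<rightarrow> carrier N" "t' \<in> carrier H \<rightarrow> carrier N"
  shows "crossed_map N H E E' t = crossed_map N H E E' t' \<longleftrightarrow> (\<forall>h \<in> carrier H. (t h, t' h) \<in> E' h)"
proof
  assume eq: "crossed_map N H E E' t = crossed_map N H E E' t'"
  show "\<forall>h \<in> carrier H. (t h, t' h) \<in> E' h"
  proof
    fix h assume h: "h \<in> carrier H"
    have "crossed_elem E' h (t h \<otimes>\<^bsub>N\<^esub> \<one>\<^bsub>N\<^esub>) = crossed_elem E' h (t' h \<otimes>\<^bsub>N\<^esub> \<one>\<^bsub>N\<^esub>)"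
      using crossed_map_elem[OF E[OF h], of t "\<one>\<^bsub>N\<^esub>"] crossed_map_elem[OF E[OF h], of t' "\<one>\<^bsub>N\<^esub>"]
        eq h funcset_mem[OF t(1) h] funcset_mem[OF t(2) h] by simp
    then show "(t h, t' h) \<in> E' h"
      using h funcset_mem[OF t(1) h] funcset_mem[OF t(2) h] by (simp add: Q.crossed_elem_eq_iff)
  qed
next
  assume r: "\<forall>h \<in> carrier H. (t h, t' h) \<in> E' h"
  show "crossed_map N H E E' t = crossed_map N H E E' t'"
  proof (rule crossed_map_eqI[OF E t(2)])
    fix h n assume h: "h \<in> carrier H" and n: "n \<in> carrier N"
    have "(t h \<otimes>\<^bsub>N\<^esub> n, t' h \<otimes>\<^bsub>N\<^esub> n) \<in> E' h" using r h n by (intro Q.E_mult_both Q.E_refl) auto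
    then show "crossed_map N H E E' t (crossed_elem E h n) = crossed_elem E' h (t' h \<otimes>\<^bsub>N\<^esub> n)"
      using crossed_map_elem[OF E[OF h] _ h n] h n funcset_mem[OF t(1) h] funcset_mem[OF t(2) h]
      by (simp add: Q.crossed_elem_eq_iff)
  qed (auto simp: crossed_map_def)
qed

end

locale two_factor_sets = two_pairs N H E E' \<phi> \<phi>'
  for N :: "('n, 'a) monoid_scheme" and H :: "('h, 'b) monoid_scheme"
    and E E' :: "'h \<Rightarrow> ('n \<times> 'n) set" and \<phi> \<phi>' :: "'h \<Rightarrow> 'n \<Rightarrow> 'n" +
  fixes g g' :: "'h \<Rightarrow> 'h \<Rightarrow> 'n"
  assumes g: "g \<in> factor_sets N H E \<phi>" and g': "g' \<in> factor_sets N H E' \<phi>'"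
begin

lemmas mult = crossed_mult[OF factor_setsD(1)[OF g]]
lemmas mult' = Q.crossed_mult[OF Q.factor_setsD(1)[OF g']]

text \<open>Modulo \<open>E' (hh')\<close>, the product of the images of \<open>([n], h)\<close> and \<open>([n'], h')\<close> is
  \<open>(n \<phi>'(h, n')) (t(h) \<phi>'(h, t(h')) g'(h, h'))\<close>. The comparison condition turns the second bracket into
  \<open>g(h, h') t(hh')\<close>, and \<open>\<phi>'\<close> may be replaced by \<open>\<phi>\<close>.\<close>

lemma crossed_map_hom:
  assumes fin: finer and t: "comparison_cochain N H E' \<phi>' g g' t"
  shows "crossed_map N H E E' t \<in> ext_hom N (crossed_product N H E \<phi> g) (crossed_product N H E' \<phi>' g')"
    (is "?f \<in> ext_hom N ?\<Gamma> ?\<Psi>")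
proof (rule ext_homI)
  note R = finerD[OF fin]
  have tc [simp]: "t h \<in> carrier N" if "h \<in> carrier H" for h
    using that t by (auto simp: comparison_cochain_def)
  have t1: "t \<one>\<^bsub>H\<^esub> = \<one>\<^bsub>N\<^esub>" using t by (simp add: comparison_cochain_def)
  have f: "?f (crossed_elem E h n) = crossed_elem E' h (t h \<otimes>\<^bsub>N\<^esub> n)"
    if "h \<in> carrier H" "n \<in> carrier N" for h n
    using that fin by (intro crossed_map_elem) (auto simp: finer_def)
  show "?f \<one>\<^bsub>mid ?\<Gamma>\<^esub> = \<one>\<^bsub>mid ?\<Psi>\<^esub>" by (simp add: crossed_product_simps f t1)
  show "?f (kmap ?\<Gamma> n) = kmap ?\<Psi> n" if "n \<in> carrier N" for n
    using that by (simp_all add: crossed_product_simps f t1)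
  show "?f \<in> extensional (carrier (mid ?\<Gamma>))" by (simp add: crossed_product_simps crossed_map_def)
  show "?f x \<in> carrier (mid ?\<Psi>)" "emap ?\<Psi> (?f x) = emap ?\<Gamma> x" if "x \<in> carrier (mid ?\<Gamma>)" for x
    using that
    by (auto simp: crossed_product_simps f Q.crossed_elem_closed snd_crossed_elem
        elim!: crossed_carrierE)
  fix x y assume "x \<in> carrier (mid ?\<Gamma>)" "y \<in> carrier (mid ?\<Gamma>)"
  then obtain h n h' n' where h [simp]: "h \<in> carrier H" "h' \<in> carrier H"
      and n [simp]: "n \<in> carrier N" "n' \<in> carrier N"
      and xy: "x = crossed_elem E h n" "y = crossed_elem E h' n'"
    unfolding crossed_product_simps by (metis crossed_carrierE)
  let ?k = "h \<otimes>\<^bsub>H\<^esub> h'"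
  have k: "?k \<in> carrier H" by simp
  note [simp] = act_closed Q.act_closed factor_setsD(2)[OF g] Q.factor_setsD(2)[OF g']
  let ?u = "t h \<otimes>\<^bsub>N\<^esub> n \<otimes>\<^bsub>N\<^esub> \<phi>' h (t h' \<otimes>\<^bsub>N\<^esub> n') \<otimes>\<^bsub>N\<^esub> g' h h'"
  have "((t h \<otimes>\<^bsub>N\<^esub> n \<otimes>\<^bsub>N\<^esub> g' h h') \<otimes>\<^bsub>N\<^esub> \<phi>' h (t h' \<otimes>\<^bsub>N\<^esub> n'),
      (t h \<otimes>\<^bsub>N\<^esub> n \<otimes>\<^bsub>N\<^esub> g' h h') \<otimes>\<^bsub>N\<^esub> (\<phi>' h (t h') \<otimes>\<^bsub>N\<^esub> \<phi>' h n')) \<in> E' ?k"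
    by (intro Q.E_mult Q.act_mult_right) auto
  then have "(?u, (n \<otimes>\<^bsub>N\<^esub> (t h \<otimes>\<^bsub>N\<^esub> \<phi>' h (t h') \<otimes>\<^bsub>N\<^esub> g' h h')) \<otimes>\<^bsub>N\<^esub> \<phi>' h n') \<in> E' ?k"
    by (simp add: N.m_ac)
  moreover have "((n \<otimes>\<^bsub>N\<^esub> (t h \<otimes>\<^bsub>N\<^esub> \<phi>' h (t h') \<otimes>\<^bsub>N\<^esub> g' h h')) \<otimes>\<^bsub>N\<^esub> \<phi>' h n',
      (n \<otimes>\<^bsub>N\<^esub> (g h h' \<otimes>\<^bsub>N\<^esub> t ?k)) \<otimes>\<^bsub>N\<^esub> \<phi> h n') \<in> E' ?k"
    using t by (intro Q.E_mult_both[OF k Q.E_mult R(5)]) (auto simp: comparison_cochain_def)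
  ultimately have "(?u, (n \<otimes>\<^bsub>N\<^esub> (g h h' \<otimes>\<^bsub>N\<^esub> t ?k)) \<otimes>\<^bsub>N\<^esub> \<phi> h n') \<in> E' ?k"
    using Q.E_trans[OF k] by blast
  then have "(?u, t ?k \<otimes>\<^bsub>N\<^esub> (n \<otimes>\<^bsub>N\<^esub> \<phi> h n' \<otimes>\<^bsub>N\<^esub> g h h')) \<in> E' ?k" by (simp add: N.m_ac)
  then have "crossed_elem E' ?k (t ?k \<otimes>\<^bsub>N\<^esub> (n \<otimes>\<^bsub>N\<^esub> \<phi> h n' \<otimes>\<^bsub>N\<^esub> g h h')) = crossed_elem E' ?k ?u"
    using Q.E_sym[OF k] by (subst Q.crossed_elem_eq_iff) auto
  then show "?f (x \<otimes>\<^bsub>mid ?\<Gamma>\<^esub> y) = ?f x \<otimes>\<^bsub>mid ?\<Psi>\<^esub> ?f y"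
    by (simp add: xy mult mult' f)
qed

text \<open>A morphism \<open>f\<close> fixes all \<open>([n], 1)\<close> and is determined by its values \<open>([t(h)], h)\<close> on the elements
  \<open>([1], h)\<close>, as \<open>([n], h) = ([n], 1)([1], h)\<close>. Well-definedness of \<open>f\<close> forces \<open>E \<subseteq> E'\<close>, since \<open>t(h)\<close> can be
  cancelled. Multiplicativity on \<open>([1], h)([n], 1)\<close> identifies the actions, and on \<open>([1], h)([1], h')\<close>
  it is the comparison of the factor sets. So the existence of a single morphism already implies
  both conditions of the theorem.\<close>

lemma ext_hom_is_crossed_map:
  assumes f: "f \<in> ext_hom N (crossed_product N H E \<phi> g) (crossed_product N H E' \<phi>' g')"
    (is "f \<in> ext_hom N ?\<Gamma> ?\<Psi>")
  obtains t where finer "comparison_cochain N H E' \<phi>' g g' t" "f = crossed_map N H E E' t"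
proof -
  note fD = ext_homD[OF f, unfolded crossed_product_simps]
  note [simp] = act_closed Q.act_closed factor_setsD(2)[OF g] Q.factor_setsD(2)[OF g']
  \<comment> \<open>\<open>t(h)\<close> is a representative of the \<open>N\<close>-component of \<open>f([1], h)\<close>.\<close>
  have "\<exists>n \<in> carrier N. f (crossed_elem E h \<one>\<^bsub>N\<^esub>) = crossed_elem E' h n" if h: "h \<in> carrier H" for h
  proof -
    let ?x = "crossed_elem E h \<one>\<^bsub>N\<^esub>"
    have x: "?x \<in> crossed_carrier N H E" using h crossed_elem_closed by simp
    from fD(1)[OF x] obtain h' n where n: "n \<in> carrier N" "f ?x = crossed_elem E' h' n"
      by (rule Q.crossed_carrierE)
    with fD(5)[OF x] show ?thesis by (auto simp: crossed_elem_def)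
  qed
  then obtain t where t: "h \<in> carrier H \<Longrightarrow> t h \<in> carrier N \<and>
      f (crossed_elem E h \<one>\<^bsub>N\<^esub>) = crossed_elem E' h (t h)" for h
    by metis
  then have tc [simp]: "t h \<in> carrier N" and ft: "f (crossed_elem E h \<one>\<^bsub>N\<^esub>) = crossed_elem E' h (t h)"
    if "h \<in> carrier H" for h
    using that by auto
  have t_fun: "t \<in> carrier H \<rightarrow> carrier N" by auto
  have f_mult: "f (crossed_elem E (h \<otimes>\<^bsub>H\<^esub> h') (n \<otimes>\<^bsub>N\<^esub> \<phi> h n' \<otimes>\<^bsub>N\<^esub> g h h'))
      = crossed_elem E' (h \<otimes>\<^bsub>H\<^esub> h') (m \<otimes>\<^bsub>N\<^esub> \<phi>' h m' \<otimes>\<^bsub>N\<^esub> g' h h')"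
    if "h \<in> carrier H" "h' \<in> carrier H" "n \<in> carrier N" "n' \<in> carrier N" "m \<in> carrier N" "m' \<in> carrier N"
      "f (crossed_elem E h n) = crossed_elem E' h m" "f (crossed_elem E h' n') = crossed_elem E' h' m'"
    for h h' n n' m m'
    using fD(2)[of "crossed_elem E h n" "crossed_elem E h' n'"] that
    by (simp add: mult mult' crossed_elem_closed)
  have fk: "f (crossed_elem E \<one>\<^bsub>H\<^esub> n) = crossed_elem E' \<one>\<^bsub>H\<^esub> n" if "n \<in> carrier N" for n
    using fD(4) that by simp
  have eqI: "crossed_elem E h n = crossed_elem E h m"
    if "h \<in> carrier H" "n \<in> carrier N" "m \<in> carrier N" "(n, m) \<in> E h" for h n m
    using that crossed_elem_eq_iff by blast
  \<comment> \<open>\<open>([n], h) = ([n], 1)([1], h)\<close>\<close>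
  have f_elem: "f (crossed_elem E h n) = crossed_elem E' h (t h \<otimes>\<^bsub>N\<^esub> n)"
    if h: "h \<in> carrier H" and n: "n \<in> carrier N" for h n
  proof -
    have "\<phi> \<one>\<^bsub>H\<^esub> \<one>\<^bsub>N\<^esub> = \<one>\<^bsub>N\<^esub>" "\<phi>' \<one>\<^bsub>H\<^esub> (t h) = t h"
      using E_one[OF act_one] Q.E_one[OF Q.act_one] h by auto
    with f_mult[OF H.one_closed h n N.one_closed n tc[OF h] fk[OF n] ft[OF h]] h n
    have "f (crossed_elem E h (n \<otimes>\<^bsub>N\<^esub> g \<one>\<^bsub>H\<^esub> h)) = crossed_elem E' h (n \<otimes>\<^bsub>N\<^esub> t h \<otimes>\<^bsub>N\<^esub> g' \<one>\<^bsub>H\<^esub> h)"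
      by simp
    moreover have "(n \<otimes>\<^bsub>N\<^esub> g \<one>\<^bsub>H\<^esub> h, n \<otimes>\<^bsub>N\<^esub> \<one>\<^bsub>N\<^esub>) \<in> E h"
      using h n factor_setsD(4)[OF g] by (intro E_mult) auto
    then have "crossed_elem E h (n \<otimes>\<^bsub>N\<^esub> g \<one>\<^bsub>H\<^esub> h) = crossed_elem E h n"
      using h n by (subst crossed_elem_eq_iff) auto
    moreover have "((n \<otimes>\<^bsub>N\<^esub> t h) \<otimes>\<^bsub>N\<^esub> g' \<one>\<^bsub>H\<^esub> h, (n \<otimes>\<^bsub>N\<^esub> t h) \<otimes>\<^bsub>N\<^esub> \<one>\<^bsub>N\<^esub>) \<in> E' h"
      using h n Q.factor_setsD(4)[OF g'] by (intro Q.E_mult) auto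
    then have "crossed_elem E' h (n \<otimes>\<^bsub>N\<^esub> t h \<otimes>\<^bsub>N\<^esub> g' \<one>\<^bsub>H\<^esub> h) = crossed_elem E' h (t h \<otimes>\<^bsub>N\<^esub> n)"
      using h n by (subst Q.crossed_elem_eq_iff) (auto simp: N.m_comm)
    ultimately show ?thesis by simp
  qed
  have E_sub: "E h \<subseteq> E' h" if h: "h \<in> carrier H" for h
  proof clarify
    fix n m assume nm: "(n, m) \<in> E h"
    note n = E_closed[OF h nm]
    have "crossed_elem E' h (t h \<otimes>\<^bsub>N\<^esub> n) = crossed_elem E' h (t h \<otimes>\<^bsub>N\<^esub> m)"
      using f_elem[OF h] eqI[OF h n nm] n by metis
    then have "(t h \<otimes>\<^bsub>N\<^esub> n, t h \<otimes>\<^bsub>N\<^esub> m) \<in> E' h" using h n by (simp add: Q.crossed_elem_eq_iff)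
    then show "(n, m) \<in> E' h" using h n by (simp add: Q.E_cancel_iff)
  qed
  \<comment> \<open>Apply \<open>f\<close> to \<open>([1], h)([n], 1)\<close>.\<close>
  have act: "(\<phi> h n, \<phi>' h n) \<in> E' h" if h: "h \<in> carrier H" and n: "n \<in> carrier N" for h n
  proof -
    have "f (crossed_elem E h (\<phi> h n \<otimes>\<^bsub>N\<^esub> g h \<one>\<^bsub>H\<^esub>))
        = crossed_elem E' h (t h \<otimes>\<^bsub>N\<^esub> \<phi>' h n \<otimes>\<^bsub>N\<^esub> g' h \<one>\<^bsub>H\<^esub>)"
      using f_mult[OF h H.one_closed N.one_closed n tc[OF h] n ft[OF h] fk[OF n]] h n by simp
    then have "(t h \<otimes>\<^bsub>N\<^esub> (\<phi> h n \<otimes>\<^bsub>N\<^esub> g h \<one>\<^bsub>H\<^esub>), t h \<otimes>\<^bsub>N\<^esub> (\<phi>' h n \<otimes>\<^bsub>N\<^esub> g' h \<one>\<^bsub>H\<^esub>)) \<in> E' h"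
      using h n by (simp add: f_elem Q.crossed_elem_eq_iff N.m_assoc)
    then have 1: "(\<phi> h n \<otimes>\<^bsub>N\<^esub> g h \<one>\<^bsub>H\<^esub>, \<phi>' h n \<otimes>\<^bsub>N\<^esub> g' h \<one>\<^bsub>H\<^esub>) \<in> E' h"
      using h n by (simp add: Q.E_cancel_iff)
    have "(\<one>\<^bsub>N\<^esub>, g h \<one>\<^bsub>H\<^esub>) \<in> E' h"
      using factor_setsD(3)[OF g h] E_sub[OF h] h Q.E_sym by blast
    then have 2: "(\<phi> h n \<otimes>\<^bsub>N\<^esub> \<one>\<^bsub>N\<^esub>, \<phi> h n \<otimes>\<^bsub>N\<^esub> g h \<one>\<^bsub>H\<^esub>) \<in> E' h"
      using h n by (intro Q.E_mult) auto
    have 3: "(\<phi>' h n \<otimes>\<^bsub>N\<^esub> g' h \<one>\<^bsub>H\<^esub>, \<phi>' h n \<otimes>\<^bsub>N\<^esub> \<one>\<^bsub>N\<^esub>) \<in> E' h"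
      using h n Q.factor_setsD(3)[OF g'] by (intro Q.E_mult) auto
    from Q.E_trans[OF h Q.E_trans[OF h 2 1] 3] show ?thesis using h n by simp
  qed
  have fin: finer unfolding finer_def using E_sub act by blast
  note R = finerD[OF fin]
  have "comparison_cochain N H E' \<phi>' g g' t"
    unfolding comparison_cochain_def
  proof (intro conjI ballI t_fun)
    have "crossed_elem E' \<one>\<^bsub>H\<^esub> (t \<one>\<^bsub>H\<^esub>) = crossed_elem E' \<one>\<^bsub>H\<^esub> \<one>\<^bsub>N\<^esub>"
      using ft[of "\<one>\<^bsub>H\<^esub>"] fk[of "\<one>\<^bsub>N\<^esub>"] by simp
    then show "t \<one>\<^bsub>H\<^esub> = \<one>\<^bsub>N\<^esub>" by (intro Q.E_one) (simp add: Q.crossed_elem_eq_iff)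
    \<comment> \<open>Apply \<open>f\<close> to \<open>([1], h)([1], h')\<close>.\<close>
    fix h h' assume h: "h \<in> carrier H" "h' \<in> carrier H"
    let ?k = "h \<otimes>\<^bsub>H\<^esub> h'"
    have k: "?k \<in> carrier H" using h by simp
    have "f (crossed_elem E ?k (\<phi> h \<one>\<^bsub>N\<^esub> \<otimes>\<^bsub>N\<^esub> g h h'))
        = crossed_elem E' ?k (t h \<otimes>\<^bsub>N\<^esub> \<phi>' h (t h') \<otimes>\<^bsub>N\<^esub> g' h h')"
      using f_mult[OF h N.one_closed N.one_closed tc[OF h(1)] tc[OF h(2)] ft[OF h(1)] ft[OF h(2)]] h
      by simp
    then have 1: "(t h \<otimes>\<^bsub>N\<^esub> \<phi>' h (t h') \<otimes>\<^bsub>N\<^esub> g' h h', t ?k \<otimes>\<^bsub>N\<^esub> (\<phi> h \<one>\<^bsub>N\<^esub> \<otimes>\<^bsub>N\<^esub> g h h')) \<in> E' ?k"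
      using h Q.E_sym[OF k] by (simp add: f_elem Q.crossed_elem_eq_iff)
    have "(\<phi> h \<one>\<^bsub>N\<^esub>, \<one>\<^bsub>N\<^esub>) \<in> E' ?k"
      using h act_unit by (intro Q.E_right R) auto
    then have "(t ?k \<otimes>\<^bsub>N\<^esub> (\<phi> h \<one>\<^bsub>N\<^esub> \<otimes>\<^bsub>N\<^esub> g h h'), t ?k \<otimes>\<^bsub>N\<^esub> (\<one>\<^bsub>N\<^esub> \<otimes>\<^bsub>N\<^esub> g h h')) \<in> E' ?k"
      using h by (intro Q.E_mult Q.E_mult_both Q.E_refl) auto
    from Q.E_trans[OF k 1 this]
    show "(t h \<otimes>\<^bsub>N\<^esub> \<phi>' h (t h') \<otimes>\<^bsub>N\<^esub> g' h h', g h h' \<otimes>\<^bsub>N\<^esub> t ?k) \<in> E' ?k"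
      using h by (simp add: N.m_comm)
  qed
  moreover have "f = crossed_map N H E E' t"
    using E_sub t_fun fD(6) f_elem by (intro crossed_map_eqI) auto
  ultimately show thesis using that fin by blast
qed

end


section \<open>Isomorphisms between crossed products over the same relation\<close>

text \<open>On each fibre over \<open>h\<close> the map is multiplication by the group element \<open>t(h)\<close>.\<close>

lemma (in compatible_pair) bij_betw_crossed_map:
  assumes t: "t \<in> carrier H \<rightarrow> carrier N"
  shows "bij_betw (crossed_map N H E E t) (crossed_carrier N H E) (crossed_carrier N H E)"
proof -
  interpret D: two_pairs N H E E \<phi> \<phi> by unfold_locales
  let ?f = "crossed_map N H E E t"
  have tc [simp]: "t h \<in> carrier N" if "h \<in> carrier H" for h using t that by auto
  have f: "?f (crossed_elem E h n) = crossed_elem E h (t h \<otimes>\<^bsub>N\<^esub> n)"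
    if "h \<in> carrier H" "n \<in> carrier N" for h n
    using that by (intro D.crossed_map_elem) auto
  show ?thesis
  proof (rule bij_betw_imageI)
    show "inj_on ?f (crossed_carrier N H E)"
    proof (rule inj_onI)
      fix x y assume "x \<in> crossed_carrier N H E" "y \<in> crossed_carrier N H E" and eq: "?f x = ?f y"
      then obtain h n h' m where h: "h \<in> carrier H" "n \<in> carrier N" "x = crossed_elem E h n"
          "h' \<in> carrier H" "m \<in> carrier N" "y = crossed_elem E h' m"
        by (metis crossed_carrierE)
      with eq have eq': "crossed_elem E h (t h \<otimes>\<^bsub>N\<^esub> n) = crossed_elem E h' (t h' \<otimes>\<^bsub>N\<^esub> m)" by (simp add: f)
      then have "h' = h" by (simp add: crossed_elem_def)
      with h eq' show "x = y" by (simp add: crossed_elem_eq_iff E_cancel_iff)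
    qed
    show "?f ` crossed_carrier N H E = crossed_carrier N H E"
    proof
      show "?f ` crossed_carrier N H E \<subseteq> crossed_carrier N H E"
        by (auto simp: f crossed_elem_closed elim!: crossed_carrierE)
      show "crossed_carrier N H E \<subseteq> ?f ` crossed_carrier N H E"
      proof
        fix x assume "x \<in> crossed_carrier N H E"
        then obtain h n where h: "h \<in> carrier H" "n \<in> carrier N" "x = crossed_elem E h n"
          by (rule crossed_carrierE)
        have "x = ?f (crossed_elem E h (inv\<^bsub>N\<^esub> t h \<otimes>\<^bsub>N\<^esub> n))"
          using h f[of h "inv\<^bsub>N\<^esub> t h \<otimes>\<^bsub>N\<^esub> n"] N.m_assoc[of "t h" "inv\<^bsub>N\<^esub> t h" n] by simp
        then show "x \<in> ?f ` crossed_carrier N H E"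
          by (rule image_eqI) (use h in \<open>simp add: crossed_elem_closed\<close>)
      qed
    qed
  qed
qed

lemma (in compatible_pair) crossed_map_iso:
  assumes \<psi>: "\<psi> \<in> act_class N H E \<phi>"
    and g: "g \<in> factor_sets N H E \<phi>" "g' \<in> factor_sets N H E \<psi>"
    and t: "comparison_cochain N H E \<psi> g g' t"
  shows "crossed_map N H E E t \<in> ext_iso N (crossed_product N H E \<phi> g) (crossed_product N H E \<psi> g')"
proof -
  interpret D: two_factor_sets N H E E \<phi> \<psi> g g'
    using \<psi> g compatible_pair_axioms
    by (auto simp: two_factor_sets_def two_factor_sets_axioms_def two_pairs_def act_class_def)
  have D.finer using \<psi> by (simp add: D.finer_def act_class_def)
  from D.crossed_map_hom[OF this t] bij_betw_crossed_map[of t] t show ?thesis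
    by (simp add: ext_iso_def crossed_product_simps comparison_cochain_def)
qed

text \<open>The isomorphism type of a crossed product depends only on the classes of its action and its factor
  set, so any chosen common representatives still describe the given extensions.\<close>

lemma (in compatible_pair) corresponds_change_representatives:
  assumes closed: "closed_diagram N \<Gamma>"
    and g: "g \<in> factor_sets N H E \<phi>" and corr: "corresponds N H \<Gamma> E \<phi> g"
    and \<psi>: "\<psi> \<in> act_class N H E \<phi>" and g': "g' \<in> coh_class N H E \<phi> g"
  shows "g' \<in> factor_sets N H E \<psi>"
    and "ext_iso N \<Gamma> (crossed_product N H E \<psi> g') \<noteq> {}"
proof -
  interpret D: two_pairs N H E E \<phi> \<psi>
    using \<psi> compatible_pair_axioms by (auto simp: two_pairs_def act_class_def)
  have fin: D.finer using \<psi> by (simp add: D.finer_def act_class_def)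
  from g' have rel: "(g, g') \<in> coh_rel N H E \<phi>" by (simp add: coh_class_def)
  then obtain t where t: "comparison_cochain N H E \<phi> g g' t" and gg: "g' \<in> factor_sets N H E \<phi>"
    by (auto simp: coh_rel_iff_comparison)
  have g'\<psi>: "g' \<in> factor_sets N H E \<psi>" using D.factor_sets_mono[OF fin] gg by blast
  then show "g' \<in> factor_sets N H E \<psi>" .
  \<comment> \<open>First keep the action and change the factor set, then keep the factor set and change the action.\<close>
  obtain \<alpha> where \<alpha>: "\<alpha> \<in> ext_iso N \<Gamma> (crossed_product N H E \<phi> g)"
    using corr by (auto simp: corresponds_def)
  have "crossed_map N H E E t \<in> ext_iso N (crossed_product N H E \<phi> g) (crossed_product N H E \<phi> g')"
    by (rule crossed_map_iso[OF act_class_self g gg t])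
  from ext_iso_compose[OF closed \<alpha> this]
  obtain \<alpha>' where \<alpha>': "\<alpha>' \<in> ext_iso N \<Gamma> (crossed_product N H E \<phi> g')" by blast
  have "crossed_map N H E E (\<lambda>_. \<one>\<^bsub>N\<^esub>)
      \<in> ext_iso N (crossed_product N H E \<phi> g') (crossed_product N H E \<psi> g')"
    by (rule crossed_map_iso[OF \<psi> gg g'\<psi> D.Q.comparison_refl[OF g'\<psi>]])
  from ext_iso_compose[OF closed \<alpha>' this]
  show "ext_iso N \<Gamma> (crossed_product N H E \<psi> g') \<noteq> {}" by blast
qed


section \<open>Crossed homomorphisms\<close>

context compatible_pair
begin

text \<open>For \<open>g = g'\<close> the factor \<open>g(h, h')\<close> cancels. The normalisation \<open>t(1) = 1\<close> is automatic: at
  \<open>h = h' = 1\<close> the condition reads \<open>t(1) = t(1) t(1)\<close>, as \<open>E 1\<close> is equality.\<close>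

lemma comparison_iff_crossed_hom:
  assumes g: "g \<in> factor_sets N H E \<phi>"
  shows "comparison_cochain N H E \<phi> g g t \<longleftrightarrow> t \<in> crossed_homs N H E \<phi>"
proof -
  have pt: "(t h \<otimes>\<^bsub>N\<^esub> \<phi> h (t h') \<otimes>\<^bsub>N\<^esub> g h h', g h h' \<otimes>\<^bsub>N\<^esub> t (h \<otimes>\<^bsub>H\<^esub> h')) \<in> E (h \<otimes>\<^bsub>H\<^esub> h') \<longleftrightarrow>
      (t (h \<otimes>\<^bsub>H\<^esub> h'), t h \<otimes>\<^bsub>N\<^esub> \<phi> h (t h')) \<in> E (h \<otimes>\<^bsub>H\<^esub> h')"
    if t: "t \<in> carrier H \<rightarrow> carrier N" and h: "h \<in> carrier H" "h' \<in> carrier H" for h h'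
  proof -
    let ?k = "h \<otimes>\<^bsub>H\<^esub> h'" and ?u = "t h \<otimes>\<^bsub>N\<^esub> \<phi> h (t h')"
    have c: "?k \<in> carrier H" "t ?k \<in> carrier N" "?u \<in> carrier N" "g h h' \<in> carrier N"
      using h factor_setsD(2)[OF g h] act_closed[OF h(1), of "t h'"] funcset_mem[OF t] by simp_all
    have "(?u \<otimes>\<^bsub>N\<^esub> g h h', g h h' \<otimes>\<^bsub>N\<^esub> t ?k) \<in> E ?k
        \<longleftrightarrow> (g h h' \<otimes>\<^bsub>N\<^esub> ?u, g h h' \<otimes>\<^bsub>N\<^esub> t ?k) \<in> E ?k"
      using c by (simp add: N.m_comm[of ?u])
    also have "\<dots> \<longleftrightarrow> (?u, t ?k) \<in> E ?k" using c by (intro E_cancel_iff)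
    also have "\<dots> \<longleftrightarrow> (t ?k, ?u) \<in> E ?k" using E_sym c by blast
    finally show ?thesis .
  qed
  have one: "t \<one>\<^bsub>H\<^esub> = \<one>\<^bsub>N\<^esub>" if "t \<in> crossed_homs N H E \<phi>"
  proof -
    have t: "t \<one>\<^bsub>H\<^esub> \<in> carrier N" using that by (auto simp: crossed_homs_def)
    have "(t (\<one>\<^bsub>H\<^esub> \<otimes>\<^bsub>H\<^esub> \<one>\<^bsub>H\<^esub>), t \<one>\<^bsub>H\<^esub> \<otimes>\<^bsub>N\<^esub> \<phi> \<one>\<^bsub>H\<^esub> (t \<one>\<^bsub>H\<^esub>)) \<in> E (\<one>\<^bsub>H\<^esub> \<otimes>\<^bsub>H\<^esub> \<one>\<^bsub>H\<^esub>)"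
      using that unfolding crossed_homs_def by blast
    then have "t \<one>\<^bsub>H\<^esub> = t \<one>\<^bsub>H\<^esub> \<otimes>\<^bsub>N\<^esub> \<phi> \<one>\<^bsub>H\<^esub> (t \<one>\<^bsub>H\<^esub>)" by (intro E_one) simp
    also have "\<phi> \<one>\<^bsub>H\<^esub> (t \<one>\<^bsub>H\<^esub>) = t \<one>\<^bsub>H\<^esub>" by (rule E_one[OF act_one[OF t]])
    finally show ?thesis using t by (metis N.r_cancel_one')
  qed
  show ?thesis
    using pt one unfolding comparison_cochain_def crossed_homs_def by blast
qed

lemma equiv_crossed_hom_rel: "equiv (crossed_homs N H E \<phi>) (crossed_hom_rel N H E \<phi>)"
proof (rule equivI)
  show "crossed_hom_rel N H E \<phi> \<subseteq> crossed_homs N H E \<phi> \<times> crossed_homs N H E \<phi>"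
    by (auto simp: crossed_hom_rel_def)
  show "refl_on (crossed_homs N H E \<phi>) (crossed_hom_rel N H E \<phi>)"
    using E_refl by (auto simp: refl_on_def crossed_hom_rel_def crossed_homs_def)
  show "sym (crossed_hom_rel N H E \<phi>)" using E_sym by (auto simp: sym_def crossed_hom_rel_def)
  show "trans (crossed_hom_rel N H E \<phi>)"
    using E_trans unfolding trans_def crossed_hom_rel_def by blast
qed

end

lemma (in two_pairs) crossed_map_one:
  assumes E: "\<And>h. h \<in> carrier H \<Longrightarrow> E h \<subseteq> E' h"
  shows "crossed_lambda N H E E' = crossed_map N H E E' (\<lambda>_. \<one>\<^bsub>N\<^esub>)"
proof -
  have "n \<in> carrier N" if "A \<in> carrier N // E h" "h \<in> carrier H" "n \<in> A" for A h n
    using that E_closed by (auto elim!: quotientE)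
  then show ?thesis
    unfolding crossed_lambda_def crossed_map_def
    by (intro restrict_ext) (auto simp: crossed_carrier_def)
qed

lemma crossed_shift_eq_crossed_map: "crossed_shift N H E t = crossed_map N H E E t"
  by (simp add: crossed_shift_def crossed_map_def)

lemma (in two_pairs) compose_shift_lambda:
  assumes E: "\<And>h. h \<in> carrier H \<Longrightarrow> E h \<subseteq> E' h" and t: "t \<in> carrier H \<rightarrow> carrier N"
  shows "compose (crossed_carrier N H E) (crossed_shift N H E' t) (crossed_lambda N H E E')
    = crossed_map N H E E' t"
proof (rule crossed_map_eqI[OF E t])
  interpret D: two_pairs N H E' E' \<phi>' \<phi>' by unfold_locales
  fix h n assume h: "h \<in> carrier H" "n \<in> carrier N"
  then show "compose (crossed_carrier N H E) (crossed_shift N H E' t) (crossed_lambda N H E E')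
      (crossed_elem E h n) = crossed_elem E' h (t h \<otimes>\<^bsub>N\<^esub> n)"
    using crossed_map_elem[OF E, of h "\<lambda>_. \<one>\<^bsub>N\<^esub>" n] D.crossed_map_elem[of h t n] funcset_mem[OF t]
    by (simp add: compose_eq crossed_elem_closed crossed_map_one[OF E] crossed_shift_eq_crossed_map)
qed (auto intro: compose_extensional)

text \<open>The choice of the representative is immaterial on the classes of crossed homomorphisms, because
  equivalent \<open>t\<close> induce the same map.\<close>

definition hom_of_class ::
    "('n, 'a) monoid_scheme \<Rightarrow> ('h, 'b) monoid_scheme \<Rightarrow> ('h \<Rightarrow> ('n \<times> 'n) set)
      \<Rightarrow> ('h \<Rightarrow> ('n \<times> 'n) set) \<Rightarrow> ('h \<Rightarrow> 'n) set \<Rightarrow> 'n set \<times> 'h \<Rightarrow> 'n set \<times> 'h"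
  where "hom_of_class N H E E' c = crossed_map N H E E' (SOME t. t \<in> c)"

locale common_factor_set = two_factor_sets N H E E' \<phi> \<phi> g g
  for N :: "('n, 'a) monoid_scheme" and H :: "('h, 'b) monoid_scheme"
    and E E' :: "'h \<Rightarrow> ('n \<times> 'n) set" and \<phi> :: "'h \<Rightarrow> 'n \<Rightarrow> 'n" and g :: "'h \<Rightarrow> 'h \<Rightarrow> 'n" +
  assumes E_le: "h \<in> carrier H \<Longrightarrow> E h \<subseteq> E' h"
begin

lemma finer: finer
  using E_le Q.E_refl act_closed by (simp add: finer_def)

lemma crossed_hom_fun: "t \<in> crossed_homs N H E' \<phi> \<Longrightarrow> t \<in> carrier H \<rightarrow> carrier N"
  by (simp add: crossed_homs_def)

text \<open>One direction makes the passage from classes to morphisms well defined, the other makes it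
  injective.\<close>

lemma crossed_map_eq_iff_rel:
  assumes "t \<in> crossed_homs N H E' \<phi>" "t' \<in> crossed_homs N H E' \<phi>"
  shows "crossed_map N H E E' t = crossed_map N H E E' t' \<longleftrightarrow> (t, t') \<in> crossed_hom_rel N H E' \<phi>"
  using assms crossed_map_eq_iff[OF E_le crossed_hom_fun crossed_hom_fun]
  by (simp add: crossed_hom_rel_def)

lemma hom_of_class:
  assumes t: "t \<in> crossed_homs N H E' \<phi>"
  shows "hom_of_class N H E E' (crossed_hom_class N H E' \<phi> t) = crossed_map N H E E' t"
proof -
  define t' where "t' = (SOME t'. t' \<in> crossed_hom_class N H E' \<phi> t)"
  have "t \<in> crossed_hom_class N H E' \<phi> t"
    unfolding crossed_hom_class_def by (rule equiv_class_self[OF Q.equiv_crossed_hom_rel t])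
  then have "t' \<in> crossed_hom_class N H E' \<phi> t" unfolding t'_def by (auto simp: some_in_eq)
  then have r: "(t, t') \<in> crossed_hom_rel N H E' \<phi>" by (simp add: crossed_hom_class_def)
  then have "t' \<in> crossed_homs N H E' \<phi>" by (simp add: crossed_hom_rel_def)
  moreover have "(t', t) \<in> crossed_hom_rel N H E' \<phi>"
    using r Q.equiv_crossed_hom_rel by (auto simp: equiv_def dest: symD)
  ultimately show ?thesis using t
    by (simp add: hom_of_class_def crossed_map_eq_iff_rel flip: t'_def)
qed

lemma ext_hom_eq_crossed_maps:
  "ext_hom N (crossed_product N H E \<phi> g) (crossed_product N H E' \<phi> g)
    = crossed_map N H E E' ` crossed_homs N H E' \<phi>"
  using crossed_map_hom[OF finer] Q.comparison_iff_crossed_hom[OF g']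
  by (auto elim!: ext_hom_is_crossed_map)

lemma bij_betw_hom_of_class:
  "bij_betw (hom_of_class N H E E') (carrier (Z1 N H E' \<phi>))
    (ext_hom N (crossed_product N H E \<phi> g) (crossed_product N H E' \<phi> g))"
proof -
  have Z1: "carrier (Z1 N H E' \<phi>) = crossed_hom_class N H E' \<phi> ` crossed_homs N H E' \<phi>"
    by (auto simp: Z1_def quotient_def crossed_hom_class_def)
  have "inj_on (hom_of_class N H E E') (carrier (Z1 N H E' \<phi>))"
  proof (rule inj_onI)
    fix c d assume "c \<in> carrier (Z1 N H E' \<phi>)" "d \<in> carrier (Z1 N H E' \<phi>)"
      and eq: "hom_of_class N H E E' c = hom_of_class N H E E' d"
    then obtain t t' where t: "t \<in> crossed_homs N H E' \<phi>" "t' \<in> crossed_homs N H E' \<phi>"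
      and cd: "c = crossed_hom_class N H E' \<phi> t" "d = crossed_hom_class N H E' \<phi> t'"
      unfolding Z1 by blast
    from eq have "(t, t') \<in> crossed_hom_rel N H E' \<phi>"
      unfolding cd hom_of_class[OF t(1)] hom_of_class[OF t(2)] crossed_map_eq_iff_rel[OF t] .
    then show "c = d"
      unfolding cd crossed_hom_class_def by (rule equiv_class_eq[OF Q.equiv_crossed_hom_rel])
  qed
  then show ?thesis
    by (simp add: bij_betw_def Z1 image_image hom_of_class ext_hom_eq_crossed_maps)
qed

lemma one_crossed_hom: "(\<lambda>_. \<one>\<^bsub>N\<^esub>) \<in> crossed_homs N H E' \<phi>"
  using Q.comparison_refl[OF g'] Q.comparison_iff_crossed_hom[OF g'] by blast

lemma hom_of_one: "hom_of_class N H E E' \<one>\<^bsub>Z1 N H E' \<phi>\<^esub> = crossed_lambda N H E E'"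
  using hom_of_class[OF one_crossed_hom] crossed_map_one[OF E_le] by (simp add: Z1_def)

lemma crossed_shift_iso:
  assumes t: "t \<in> crossed_homs N H E' \<phi>"
  shows "crossed_shift N H E' t \<in> ext_iso N (crossed_product N H E' \<phi> g) (crossed_product N H E' \<phi> g)"
  unfolding crossed_shift_eq_crossed_map
proof (rule Q.crossed_map_iso[OF Q.act_class_self g' g'])
  show "comparison_cochain N H E' \<phi> g g t" using t Q.comparison_iff_crossed_hom[OF g'] by blast
qed

end


section \<open>The hom-sets between cosetal extensions\<close>

theorem theorem2p13:
  fixes N :: "('n, 'a) monoid_scheme" and H :: "('h, 'b) monoid_scheme"
    and \<Gamma> :: "('n, 'p, 'h) ext_diagram" and \<Psi> :: "('n, 'q, 'h) ext_diagram"
    and E E' :: "'h \<Rightarrow> ('n \<times> 'n) set"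
    and \<phi>\<^sub>1 \<phi>\<^sub>2 :: "'h \<Rightarrow> 'n \<Rightarrow> 'n"
    and g\<^sub>1 g\<^sub>2 :: "'h \<Rightarrow> 'h \<Rightarrow> 'n"
  assumes "monoid H" and "comm_group N"
    and "compatible_pair N H E \<phi>\<^sub>1" and "compatible_pair N H E' \<phi>\<^sub>2"
    and "cosetal_extension N H \<Gamma>" and "cosetal_extension N H \<Psi>"
    and "coh_class N H E \<phi>\<^sub>1 g\<^sub>1 \<in> carrier (H2 N H E \<phi>\<^sub>1)"
    and "coh_class N H E' \<phi>\<^sub>2 g\<^sub>2 \<in> carrier (H2 N H E' \<phi>\<^sub>2)"
    and "corresponds N H \<Gamma> E \<phi>\<^sub>1 g\<^sub>1" and "corresponds N H \<Psi> E' \<phi>\<^sub>2 g\<^sub>2"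
  shows "(\<not> (pair_le N H E \<phi>\<^sub>1 E' \<phi>\<^sub>2 \<and> coh_class N H E' \<phi>\<^sub>2 g\<^sub>1 = coh_class N H E' \<phi>\<^sub>2 g\<^sub>2)
           \<longrightarrow> ext_hom N \<Gamma> \<Psi> = {}) \<and>
         (pair_le N H E \<phi>\<^sub>1 E' \<phi>\<^sub>2 \<and> coh_class N H E' \<phi>\<^sub>2 g\<^sub>1 = coh_class N H E' \<phi>\<^sub>2 g\<^sub>2
           \<longrightarrow> (\<exists>\<phi> g. common_reps N H E \<phi>\<^sub>1 g\<^sub>1 E' \<phi>\<^sub>2 g\<^sub>2 \<phi> g) \<and>
               (\<forall>\<phi> g. common_reps N H E \<phi>\<^sub>1 g\<^sub>1 E' \<phi>\<^sub>2 g\<^sub>2 \<phi> g \<longrightarrow>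
                 (let \<Gamma>' = crossed_product N H E \<phi> g;
                      \<Psi>' = crossed_product N H E' \<phi> g;
                      l = crossed_lambda N H E E'
                  in ext_iso N \<Gamma> \<Gamma>' \<noteq> {} \<and> ext_iso N \<Psi> \<Psi>' \<noteq> {} \<and>
                     l \<in> ext_hom N \<Gamma>' \<Psi>' \<and>
                     (\<forall>t \<in> crossed_homs N H E' \<phi>. crossed_shift N H E' t \<in> ext_iso N \<Psi>' \<Psi>') \<and>
                     (\<exists>\<Theta>. bij_betw \<Theta> (carrier (Z1 N H E' \<phi>)) (ext_hom N \<Gamma>' \<Psi>') \<and>
                          (\<forall>t \<in> crossed_homs N H E' \<phi>.
                             \<Theta> (crossed_hom_class N H E' \<phi> t)
                               = compose (carrier (mid \<Gamma>')) (crossed_shift N H E' t) l) \<and>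
                          \<Theta> \<one>\<^bsub>Z1 N H E' \<phi>\<^esub> = l \<and>
                          (\<forall>\<alpha> \<in> ext_iso N \<Gamma> \<Gamma>'. \<forall>\<beta> \<in> ext_iso N \<Psi> \<Psi>'.
                             bij_betw
                               (\<lambda>c. compose (carrier (mid \<Gamma>)) (inv_into (carrier (mid \<Psi>)) \<beta>)
                                      (compose (carrier (mid \<Gamma>)) (\<Theta> c) \<alpha>))
                               (carrier (Z1 N H E' \<phi>)) (ext_hom N \<Gamma> \<Psi>))))))"
proof -
  interpret P1: compatible_pair N H E \<phi>\<^sub>1 by fact
  interpret P2: compatible_pair N H E' \<phi>\<^sub>2 by fact
  have g1: "g\<^sub>1 \<in> factor_sets N H E \<phi>\<^sub>1" by (rule P1.factor_set_if_class_in_H2) fact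
  have g2: "g\<^sub>2 \<in> factor_sets N H E' \<phi>\<^sub>2" by (rule P2.factor_set_if_class_in_H2) fact
  interpret T: two_factor_sets N H E E' \<phi>\<^sub>1 \<phi>\<^sub>2 g\<^sub>1 g\<^sub>2 by unfold_locales (fact g1 g2)+
  have \<Gamma>: "closed_diagram N \<Gamma>" and \<Psi>: "closed_diagram N \<Psi>"
    using assms(5,6) by (auto intro: extension.closed_diagram simp: cosetal_extension_def)
  let ?le = "pair_le N H E \<phi>\<^sub>1 E' \<phi>\<^sub>2 \<and> coh_class N H E' \<phi>\<^sub>2 g\<^sub>1 = coh_class N H E' \<phi>\<^sub>2 g\<^sub>2"
  have hom_imp: ?le if f: "f \<in> ext_hom N \<Gamma> \<Psi>" for f
  proof -
    from \<open>corresponds N H \<Gamma> E \<phi>\<^sub>1 g\<^sub>1\<close> obtain \<alpha>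
      where \<alpha>: "\<alpha> \<in> ext_iso N \<Gamma> (crossed_product N H E \<phi>\<^sub>1 g\<^sub>1)" by (auto simp: corresponds_def)
    from \<open>corresponds N H \<Psi> E' \<phi>\<^sub>2 g\<^sub>2\<close> obtain \<beta>
      where \<beta>: "\<beta> \<in> ext_iso N \<Psi> (crossed_product N H E' \<phi>\<^sub>2 g\<^sub>2)" by (auto simp: corresponds_def)
    have "bij_betw (\<lambda>f. compose (carrier (mid \<Gamma>)) (inv_into (carrier (mid \<Psi>)) \<beta>) (compose (carrier (mid \<Gamma>)) f \<alpha>))
        (ext_hom N (crossed_product N H E \<phi>\<^sub>1 g\<^sub>1) (crossed_product N H E' \<phi>\<^sub>2 g\<^sub>2)) (ext_hom N \<Gamma> \<Psi>)"
      using P1.factor_setsD(1)[OF g1] P2.factor_setsD(1)[OF g2]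
      by (intro bij_betw_ext_hom_conjugate \<alpha> \<beta> \<Gamma> \<Psi> P1.closed_crossed_product P2.closed_crossed_product)
    then obtain f' where "f' \<in> ext_hom N (crossed_product N H E \<phi>\<^sub>1 g\<^sub>1) (crossed_product N H E' \<phi>\<^sub>2 g\<^sub>2)"
      using f by (auto simp: bij_betw_def)
    then obtain t where fin: T.finer and t: "comparison_cochain N H E' \<phi>\<^sub>2 g\<^sub>1 g\<^sub>2 t"
      by (rule T.ext_hom_is_crossed_map)
    have "g\<^sub>1 \<in> factor_sets N H E' \<phi>\<^sub>2" using T.factor_sets_mono[OF fin] g1 by blast
    then have "(g\<^sub>1, g\<^sub>2) \<in> coh_rel N H E' \<phi>\<^sub>2" using g2 t by (auto simp: P2.coh_rel_iff_comparison)
    then show ?le using fin g2 by (simp add: T.pair_le_iff_finer P2.coh_class_eq_iff)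
  qed
  \<comment> \<open>The finer pair's data \<open>\<phi>\<^sub>1, g\<^sub>1\<close> represent both classes.\<close>
  have reps: "common_reps N H E \<phi>\<^sub>1 g\<^sub>1 E' \<phi>\<^sub>2 g\<^sub>2 \<phi>\<^sub>1 g\<^sub>1" if le: ?le
  proof -
    have fin: T.finer using le by (simp add: T.pair_le_iff_finer)
    have "\<phi>\<^sub>1 \<in> act_class N H E' \<phi>\<^sub>1"
      by (rule compatible_pair.act_class_self[OF T.compatible_if_finer[OF fin]])
    then have "\<phi>\<^sub>1 \<in> act_class N H E' \<phi>\<^sub>2" using le by (simp add: pair_le_def)
    moreover note P1.act_class_self
    moreover have "g\<^sub>1 \<in> coh_class N H E \<phi>\<^sub>1 g\<^sub>1"
      unfolding coh_class_def by (rule equiv_class_self[OF P1.equiv_coh_rel g1])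
    moreover have "g\<^sub>1 \<in> factor_sets N H E' \<phi>\<^sub>2" using T.factor_sets_mono[OF fin] g1 by blast
    then have "g\<^sub>1 \<in> coh_class N H E' \<phi>\<^sub>2 g\<^sub>1"
      unfolding coh_class_def by (rule equiv_class_self[OF P2.equiv_coh_rel])
    then have "g\<^sub>1 \<in> coh_class N H E' \<phi>\<^sub>2 g\<^sub>2" using le by simp
    ultimately show ?thesis by (simp add: common_reps_def)
  qed
  let ?\<Theta> = "hom_of_class N H E E'"
  have main: "let \<Gamma>' = crossed_product N H E \<phi> g;
                  \<Psi>' = crossed_product N H E' \<phi> g;
                  l = crossed_lambda N H E E'
      in ext_iso N \<Gamma> \<Gamma>' \<noteq> {} \<and> ext_iso N \<Psi> \<Psi>' \<noteq> {} \<and>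
         l \<in> ext_hom N \<Gamma>' \<Psi>' \<and>
         (\<forall>t \<in> crossed_homs N H E' \<phi>. crossed_shift N H E' t \<in> ext_iso N \<Psi>' \<Psi>') \<and>
         (bij_betw ?\<Theta> (carrier (Z1 N H E' \<phi>)) (ext_hom N \<Gamma>' \<Psi>') \<and>
              (\<forall>t \<in> crossed_homs N H E' \<phi>.
                 ?\<Theta> (crossed_hom_class N H E' \<phi> t)
                   = compose (carrier (mid \<Gamma>')) (crossed_shift N H E' t) l) \<and>
              ?\<Theta> \<one>\<^bsub>Z1 N H E' \<phi>\<^esub> = l \<and>
              (\<forall>\<alpha> \<in> ext_iso N \<Gamma> \<Gamma>'. \<forall>\<beta> \<in> ext_iso N \<Psi> \<Psi>'.
                 bij_betw
                   (\<lambda>c. compose (carrier (mid \<Gamma>)) (inv_into (carrier (mid \<Psi>)) \<beta>)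
                          (compose (carrier (mid \<Gamma>)) (?\<Theta> c) \<alpha>))
                   (carrier (Z1 N H E' \<phi>)) (ext_hom N \<Gamma> \<Psi>)))"
    if le: ?le and r: "common_reps N H E \<phi>\<^sub>1 g\<^sub>1 E' \<phi>\<^sub>2 g\<^sub>2 \<phi> g" for \<phi> g
  proof -
    have \<phi>: "\<phi> \<in> act_class N H E \<phi>\<^sub>1" "\<phi> \<in> act_class N H E' \<phi>\<^sub>2"
      and gc: "g \<in> coh_class N H E \<phi>\<^sub>1 g\<^sub>1" "g \<in> coh_class N H E' \<phi>\<^sub>2 g\<^sub>2"
      using r by (auto simp: common_reps_def)
    note c1 = P1.corresponds_change_representatives[OF \<Gamma> g1 \<open>corresponds N H \<Gamma> E \<phi>\<^sub>1 g\<^sub>1\<close> \<phi>(1) gc(1)]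
    note c2 = P2.corresponds_change_representatives[OF \<Psi> g2 \<open>corresponds N H \<Psi> E' \<phi>\<^sub>2 g\<^sub>2\<close> \<phi>(2) gc(2)]
    interpret C: common_factor_set N H E E' \<phi> g
      using \<phi> c1(1) c2(1) le
      by (auto simp: common_factor_set_def common_factor_set_axioms_def two_factor_sets_def
          two_factor_sets_axioms_def two_pairs_def act_class_def pair_le_def)
    let ?\<Gamma>' = "crossed_product N H E \<phi> g" and ?\<Psi>' = "crossed_product N H E' \<phi> g"
    have closed: "closed_diagram N ?\<Gamma>'" "closed_diagram N ?\<Psi>'"
      using C.closed_crossed_product[OF C.factor_setsD(1)[OF C.g]]
        C.Q.closed_crossed_product[OF C.Q.factor_setsD(1)[OF C.g']] .
    have lambda: "crossed_lambda N H E E' \<in> ext_hom N ?\<Gamma>' ?\<Psi>'"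
      using imageI[OF C.one_crossed_hom]
      by (simp add: C.crossed_map_one[OF C.E_le] C.ext_hom_eq_crossed_maps)
    have \<Theta>_class: "?\<Theta> (crossed_hom_class N H E' \<phi> t)
        = compose (carrier (mid ?\<Gamma>')) (crossed_shift N H E' t) (crossed_lambda N H E E')"
      if "t \<in> crossed_homs N H E' \<phi>" for t
      using that C.hom_of_class C.compose_shift_lambda[OF C.E_le C.crossed_hom_fun]
      by (simp add: crossed_product_simps)
    have conj: "bij_betw
           (\<lambda>c. compose (carrier (mid \<Gamma>)) (inv_into (carrier (mid \<Psi>)) \<beta>)
                  (compose (carrier (mid \<Gamma>)) (?\<Theta> c) \<alpha>))
           (carrier (Z1 N H E' \<phi>)) (ext_hom N \<Gamma> \<Psi>)"
      if "\<alpha> \<in> ext_iso N \<Gamma> ?\<Gamma>'" "\<beta> \<in> ext_iso N \<Psi> ?\<Psi>'" for \<alpha> \<beta>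
      using bij_betw_trans[OF C.bij_betw_hom_of_class
          bij_betw_ext_hom_conjugate[OF \<Gamma> closed(1) \<Psi> closed(2) that]]
      by (simp add: comp_def)
    show ?thesis
      unfolding Let_def
      using c1(2) c2(2) lambda C.crossed_shift_iso C.bij_betw_hom_of_class \<Theta>_class C.hom_of_one conj
      by blast
  qed
  show ?thesis
  proof (intro conjI impI allI)
    assume "\<not> ?le"
    then show "ext_hom N \<Gamma> \<Psi> = {}" using hom_imp by blast
  next
    assume ?le
    then show "\<exists>\<phi> g. common_reps N H E \<phi>\<^sub>1 g\<^sub>1 E' \<phi>\<^sub>2 g\<^sub>2 \<phi> g" using reps by blast
  next
    fix \<phi> g assume ?le "common_reps N H E \<phi>\<^sub>1 g\<^sub>1 E' \<phi>\<^sub>2 g\<^sub>2 \<phi> g"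
    from main[OF this] show "let \<Gamma>' = crossed_product N H E \<phi> g;
                      \<Psi>' = crossed_product N H E' \<phi> g;
                      l = crossed_lambda N H E E'
                  in ext_iso N \<Gamma> \<Gamma>' \<noteq> {} \<and> ext_iso N \<Psi> \<Psi>' \<noteq> {} \<and>
                     l \<in> ext_hom N \<Gamma>' \<Psi>' \<and>
                     (\<forall>t \<in> crossed_homs N H E' \<phi>. crossed_shift N H E' t \<in> ext_iso N \<Psi>' \<Psi>') \<and>
                     (\<exists>\<Theta>. bij_betw \<Theta> (carrier (Z1 N H E' \<phi>)) (ext_hom N \<Gamma>' \<Psi>') \<and>
                          (\<forall>t \<in> crossed_homs N H E' \<phi>.
                             \<Theta> (crossed_hom_class N H E' \<phi> t)
                               = compose (carrier (mid \<Gamma>')) (crossed_shift N H E' t) l) \<and>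
                          \<Theta> \<one>\<^bsub>Z1 N H E' \<phi>\<^esub> = l \<and>
                          (\<forall>\<alpha> \<in> ext_iso N \<Gamma> \<Gamma>'. \<forall>\<beta> \<in> ext_iso N \<Psi> \<Psi>'.
                             bij_betw
                               (\<lambda>c. compose (carrier (mid \<Gamma>)) (inv_into (carrier (mid \<Psi>)) \<beta>)
                                      (compose (carrier (mid \<Gamma>)) (\<Theta> c) \<alpha>))
                               (carrier (Z1 N H E' \<phi>)) (ext_hom N \<Gamma> \<Psi>)))"
      unfolding Let_def by blast
  qed
qed

end
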